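(* Let $S$ be a smooth projective surface over $\mathbb{C}$ and let $\mu$ be a non-trivial algebraic semigroup law on $S$, given by $\mu(s_1,s_2)=\sigma\big(\tilde\mu(\pi(s_1),\pi(s_2))\big)$ with $\pi:S\to C$, $\sigma:C\to S$, $\tilde\mu:C\times C\to C$ as in the definition of non-trivial law. Let $\varphi:S'\to S$ be the blowing-up of an arbitrary point $P$ of $S$. Then $S'$ has a unique non-trivial algebraic semigroup structure such that $\varphi$ is a homomorphism of semigroups.
   Context: All varieties are over $\mathbb{C}$. An algebraic semigroup $(S,\mu)$ is a variety $S$ with a morphism $\mu:S\times S\to S$ that is associative. An algebraic semigroup law $\mu$ on a smooth projective surface $S$ is called non-trivial if there are a smooth projective curve $C$, a morphism $\pi:S\to C$ and a section $\sigma:C\to S$ of $\pi$ (that is, $\pi\circ\sigma=\mathrm{id}_C$) such that $\mu(s_1,s_2)=\sigma\big(\tilde\mu(\pi(s_1),\pi(s_2))\big)$ for all $s_1,s_2\in S$, where $\tilde\mu$ is one of the following algebraic semigroup laws on $C$: (i) $C$ is an elliptic curve and $\tilde\mu$ is its group law; (ii) $\tilde\mu(x_1,x_2)=x_1$; (iii) $\tilde\mu(x_1,x_2)=x_2$. *)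

theory Defs
  imports
    "HOL-Analysis.Analysis"
    "HOL-Library.Function_Algebras"
    "HOL-Library.Extended_Nat"
    "HOL-Algebra.Group"
begin

text \<open>
  Projective varieties over the complex numbers in the classical sense.  The homogeneous coordinates
  of a projective space are labelled by a finite subset of an index type \<open>'i\<close>; coordinates outside
  that set are zero.  Ordinary projective \<open>n\<close>-space is the case \<open>'i = nat\<close> with labels \<open>{..n}\<close>;
  other index types occur only for products, through the Segre embedding.

  A point is the set of all its homogeneous coordinate vectors, so \<open>v \<in> x\<close> says that \<open>v\<close> is a
  coordinate vector of the point \<open>x\<close>, and \<open>\<Union>X\<close> is the affine cone over \<open>X\<close> without its vertex.
\<close>

type_synonym 'i point = "('i \<Rightarrow> complex) set"

definition proj_class :: "('i \<Rightarrow> complex) \<Rightarrow> 'i point" where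
  "proj_class v = {w. \<exists>c. c \<noteq> 0 \<and> w = (\<lambda>i. c * v i)}"

definition proj_space :: "'i set \<Rightarrow> 'i point set" where
  "proj_space I = proj_class ` {v. v \<noteq> (\<lambda>i. 0) \<and> (\<forall>i. i \<notin> I \<longrightarrow> v i = 0)}"

text \<open>
  Homogeneous polynomials, identified with the functions they define (the field being infinite).
\<close>

inductive form :: "nat \<Rightarrow> (('i \<Rightarrow> complex) \<Rightarrow> complex) \<Rightarrow> bool" where
  form_const: "form 0 (\<lambda>v. c)"
| form_coord: "form 1 (\<lambda>v. v i)"
| form_add: "form d F \<Longrightarrow> form d G \<Longrightarrow> form d (\<lambda>v. F v + G v)"
| form_mult: "form d F \<Longrightarrow> form e G \<Longrightarrow> form (d + e) (\<lambda>v. F v * G v)"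

definition zero_locus :: "(('i \<Rightarrow> complex) \<Rightarrow> complex) set \<Rightarrow> 'i point set" where
  "zero_locus T = {x \<in> proj_space UNIV. \<forall>F\<in>T. \<forall>v\<in>x. F v = 0}"

definition zariski_open :: "'i point set \<Rightarrow> bool" where
  "zariski_open U \<longleftrightarrow> (\<exists>T. (\<forall>F\<in>T. \<exists>d. form d F) \<and> U = proj_space UNIV - zero_locus T)"

text \<open>
  One topology serves all projective spaces over the index type: it induces the usual Zariski
  topology on \<open>proj_space I\<close>, which is itself closed.
\<close>

definition zariski :: "'i point topology" where
  "zariski = topology zariski_open"

lemma istopology_zariski_open: "istopology (zariski_open :: 'i point set \<Rightarrow> bool)"
  unfolding istopology_def
proof (intro conjI allI impI)
  fix U V :: "'i point set"
  assume "zariski_open U" "zariski_open V"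
  then obtain S T where
    S: "\<forall>F\<in>S. \<exists>d. form d F" "U = proj_space UNIV - zero_locus S" and
    T: "\<forall>F\<in>T. \<exists>d. form d F" "V = proj_space UNIV - zero_locus T"
    unfolding zariski_open_def by blast
  define R where "R = {(\<lambda>v. F v * G v) |F G. F \<in> S \<and> G \<in> T}"
  have hom: "\<forall>H\<in>R. \<exists>d. form d H"
    unfolding R_def using S(1) T(1) form_mult by blast
  have const: "F v = 0" if "form d F" "F w = 0" "v \<in> x" "w \<in> x" "x \<in> proj_space UNIV"
    for F :: "('i \<Rightarrow> complex) \<Rightarrow> complex" and d v w x
  proof -
    from that(3-5) obtain u c e where *: "c \<noteq> 0" "e \<noteq> 0" "v = (\<lambda>i. c * u i)" "w = (\<lambda>i. e * u i)"
      unfolding proj_space_def proj_class_def by blast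
    have scale: "F (\<lambda>i. k * u i) = k ^ d * F u" for k u
      using that(1) by induction (auto simp: algebra_simps power_add)
    show ?thesis using that(2) * by (auto simp: scale)
  qed
  have "zero_locus R = zero_locus S \<union> zero_locus T"
  proof (intro equalityI subsetI)
    fix x assume x: "x \<in> zero_locus R"
    show "x \<in> zero_locus S \<union> zero_locus T"
    proof (rule ccontr)
      assume "\<not> ?thesis"
      with x obtain F v G w where *: "F \<in> S" "v \<in> x" "F v \<noteq> 0" "G \<in> T" "w \<in> x" "G w \<noteq> 0"
        unfolding zero_locus_def by blast
      have xp: "x \<in> proj_space UNIV" using x by (simp add: zero_locus_def)
      obtain d where d: "form d G" using T(1) *(4) by blast
      have "G v \<noteq> 0" using const[OF d _ *(5) *(2) xp] *(6) by blast
      moreover have "(\<lambda>v. F v * G v) \<in> R" unfolding R_def using *(1,4) by blast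
      moreover have "\<forall>H\<in>R. \<forall>v\<in>x. H v = 0" using x by (simp add: zero_locus_def)
      ultimately have "G v \<noteq> 0" "F v * G v = 0" using *(2) by fast+
      then show False using *(3) by simp
    qed
  next
    fix x assume "x \<in> zero_locus S \<union> zero_locus T"
    then show "x \<in> zero_locus R" unfolding zero_locus_def R_def by auto
  qed
  then have "U \<inter> V = proj_space UNIV - zero_locus R"
    using S(2) T(2) by blast
  then show "zariski_open (U \<inter> V)"
    unfolding zariski_open_def using hom by blast
next
  fix \<U> :: "'i point set set"
  assume "\<forall>U\<in>\<U>. zariski_open U"
  then have "\<forall>U\<in>\<U>. \<exists>T. (\<forall>F\<in>T. \<exists>d. form d F) \<and> U = proj_space UNIV - zero_locus T"
    unfolding zariski_open_def by blast
  then obtain T where T: "\<And>U. U \<in> \<U> \<Longrightarrow> \<forall>F\<in>T U. \<exists>d. form d F"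
    "\<And>U. U \<in> \<U> \<Longrightarrow> U = proj_space UNIV - zero_locus (T U)"
    by metis
  have "(\<Union>U\<in>\<U>. U) = (\<Union>U\<in>\<U>. proj_space UNIV - zero_locus (T U))"
    by (rule SUP_cong[OF refl T(2)])
  also have "\<dots> = proj_space UNIV - zero_locus (\<Union>U\<in>\<U>. T U)"
    unfolding zero_locus_def by blast
  finally have "\<Union>\<U> = proj_space UNIV - zero_locus (\<Union>U\<in>\<U>. T U)"
    by simp
  moreover have "\<forall>F\<in>(\<Union>U\<in>\<U>. T U). \<exists>d. form d F"
    using T(1) by fast
  ultimately show "zariski_open (\<Union>\<U>)"
    unfolding zariski_open_def by (intro exI conjI)
qed

definition irreducible_set :: "'i point set \<Rightarrow> bool" where
  "irreducible_set X \<longleftrightarrow> X \<noteq> {} \<and>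
     (\<forall>A B. closedin zariski A \<and> closedin zariski B \<and> X \<subseteq> A \<union> B \<longrightarrow> X \<subseteq> A \<or> X \<subseteq> B)"

definition projective_variety :: "'i point set \<Rightarrow> bool" where
  "projective_variety X \<longleftrightarrow>
     (\<exists>I. finite I \<and> X \<subseteq> proj_space I) \<and> closedin zariski X \<and> irreducible_set X"

definition krull_dim :: "'i point set \<Rightarrow> enat" where
  "krull_dim X = (SUP n \<in> {n. \<exists>Z.
      (\<forall>k\<le>n. closedin zariski (Z k) \<and> irreducible_set (Z k) \<and> Z k \<subseteq> X) \<and>
      (\<forall>k<n. Z k \<subset> Z (Suc k))}. enat n)"

definition fun_scale :: "complex \<Rightarrow> ('a \<Rightarrow> complex) \<Rightarrow> 'a \<Rightarrow> complex" where
  "fun_scale c f = (\<lambda>a. c * f a)"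

interpretation cfun: vector_space fun_scale
  by unfold_locales (auto simp: fun_scale_def algebra_simps fun_eq_iff)

text \<open>
  The tangent space of the affine cone over \<open>X\<close> at \<open>v\<close>, that is, the kernel of the Jacobian matrix of
  the homogeneous ideal of \<open>X\<close>.  Coordinates \<open>i\<close> vanishing on \<open>X\<close> belong to this ideal, so tangent
  vectors are supported on the labels of the ambient projective space.
\<close>

definition cone_tangent_space :: "'i point set \<Rightarrow> ('i \<Rightarrow> complex) \<Rightarrow> ('i \<Rightarrow> complex) set" where
  "cone_tangent_space X v = {w. \<forall>d F. form d F \<and> (\<forall>u\<in>\<Union>X. F u = 0) \<longrightarrow>
     deriv (\<lambda>t::complex. F (\<lambda>i. v i + t * w i)) 0 = 0}"

text \<open>The Jacobian criterion; the cone has one dimension more than \<open>X\<close>.\<close>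

definition smooth :: "'i point set \<Rightarrow> bool" where
  "smooth X \<longleftrightarrow> (\<forall>v\<in>\<Union>X. enat (cfun.dim (cone_tangent_space X v)) = krull_dim X + 1)"

definition smooth_projective_curve :: "'i point set \<Rightarrow> bool" where
  "smooth_projective_curve C \<longleftrightarrow> projective_variety C \<and> smooth C \<and> krull_dim C = 1"

definition smooth_projective_surface :: "'i point set \<Rightarrow> bool" where
  "smooth_projective_surface S \<longleftrightarrow> projective_variety S \<and> smooth S \<and> krull_dim S = 2"

text \<open>
  A morphism is given, locally in the Zariski topology, by forms of one and the same degree.  Points
  consist of nonzero vectors, so these forms have no common zero on \<open>U \<inter> X\<close>.
\<close>

definition morphism :: "'i point set \<Rightarrow> 'j point set \<Rightarrow> ('i point \<Rightarrow> 'j point) \<Rightarrow> bool" where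
  "morphism X Y f \<longleftrightarrow> f ` X \<subseteq> Y \<and>
     (\<forall>x\<in>X. \<exists>U d F. openin zariski U \<and> x \<in> U \<and> (\<forall>j. form d (F j)) \<and>
        (\<forall>y\<in>U \<inter> X. \<forall>v\<in>y. (\<lambda>j. F j v) \<in> f y))"

definition isomorphism :: "'i point set \<Rightarrow> 'j point set \<Rightarrow> ('i point \<Rightarrow> 'j point) \<Rightarrow> bool" where
  "isomorphism X Y f \<longleftrightarrow> bij_betw f X Y \<and> morphism X Y f \<and> morphism Y X (inv_into X f)"

definition segre :: "'i point \<times> 'j point \<Rightarrow> ('i \<times> 'j) point" where
  "segre = (\<lambda>(x, y). {\<lambda>(i, j). v i * w j |v w. v \<in> x \<and> w \<in> y})"

definition segre_inv :: "('i \<times> 'j) point \<Rightarrow> 'i point \<times> 'j point" where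
  "segre_inv = the_inv_into (proj_space UNIV \<times> proj_space UNIV) segre"

text \<open>Morphisms out of a product, the product being embedded by the Segre map.\<close>

definition morphism_prod ::
    "'i point set \<Rightarrow> 'j point set \<Rightarrow> 'k point set \<Rightarrow> ('i point \<times> 'j point \<Rightarrow> 'k point) \<Rightarrow> bool" where
  "morphism_prod X Y Z f \<longleftrightarrow> morphism (segre ` (X \<times> Y)) Z (\<lambda>z. f (segre_inv z))"

definition algebraic_semigroup_law :: "'i point set \<Rightarrow> ('i point \<times> 'i point \<Rightarrow> 'i point) \<Rightarrow> bool" where
  "algebraic_semigroup_law S \<mu> \<longleftrightarrow> morphism_prod S S S \<mu> \<and>
     (\<forall>a\<in>S. \<forall>b\<in>S. \<forall>c\<in>S. \<mu> (\<mu> (a, b), c) = \<mu> (a, \<mu> (b, c)))"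

text \<open>The dimension of the degree \<open>d\<close> part of the homogeneous coordinate ring.\<close>

definition hilbert_function :: "'i point set \<Rightarrow> nat \<Rightarrow> nat" where
  "hilbert_function X d = cfun.dim ((\<lambda>F v. if v \<in> \<Union>X then F v else 0) ` {F. form d F})"

text \<open>A curve \<open>C\<close> with Hilbert polynomial \<open>p\<close> has genus \<open>1 - p(0)\<close>.\<close>

definition curve_genus :: "'i point set \<Rightarrow> int \<Rightarrow> bool" where
  "curve_genus C g \<longleftrightarrow> (\<exists>e. \<forall>\<^sub>F d in sequentially. int (hilbert_function C d) = e * int d + (1 - g))"

text \<open>
  An elliptic curve with its group law: a smooth projective curve of genus one carrying the structure
  of a commutative algebraic group.  Such a structure is determined by its neutral element, the
  chosen origin of the elliptic curve.
\<close>

definition elliptic_curve_group_law :: "'i point set \<Rightarrow> ('i point \<times> 'i point \<Rightarrow> 'i point) \<Rightarrow> bool" where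
  "elliptic_curve_group_law C m \<longleftrightarrow> smooth_projective_curve C \<and> curve_genus C 1 \<and>
     (\<exists>e. let G = \<lparr>carrier = C, monoid.mult = (\<lambda>x y. m (x, y)), one = e\<rparr> in
        comm_group G \<and> morphism_prod C C C m \<and> morphism C C (\<lambda>x. inv\<^bsub>G\<^esub> x))"

definition curve_law :: "'i point set \<Rightarrow> ('i point \<times> 'i point \<Rightarrow> 'i point) \<Rightarrow> bool" where
  "curve_law C m \<longleftrightarrow> elliptic_curve_group_law C m \<or>
     (\<forall>x\<in>C. \<forall>y\<in>C. m (x, y) = x) \<or> (\<forall>x\<in>C. \<forall>y\<in>C. m (x, y) = y)"

definition nontrivial_law_via ::
    "'i point set \<Rightarrow> ('i point \<times> 'i point \<Rightarrow> 'i point) \<Rightarrow>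
     nat point set \<Rightarrow> ('i point \<Rightarrow> nat point) \<Rightarrow> (nat point \<Rightarrow> 'i point) \<Rightarrow>
     (nat point \<times> nat point \<Rightarrow> nat point) \<Rightarrow> bool" where
  "nontrivial_law_via S \<mu> C \<pi> \<sigma> m \<longleftrightarrow>
     smooth_projective_curve C \<and> morphism S C \<pi> \<and> morphism C S \<sigma> \<and> (\<forall>c\<in>C. \<pi> (\<sigma> c) = c) \<and>
     curve_law C m \<and> (\<forall>a\<in>S. \<forall>b\<in>S. \<mu> (a, b) = \<sigma> (m (\<pi> a, \<pi> b)))"

definition nontrivial_semigroup_law :: "'i point set \<Rightarrow> ('i point \<times> 'i point \<Rightarrow> 'i point) \<Rightarrow> bool" where
  "nontrivial_semigroup_law S \<mu> \<longleftrightarrow>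
     algebraic_semigroup_law S \<mu> \<and> (\<exists>C \<pi> \<sigma> m. nontrivial_law_via S \<mu> C \<pi> \<sigma> m)"

text \<open>
  The blow-up of \<open>X\<close> at \<open>P\<close> is the closure of the graph of the rational map defined by the linear
  forms \<open>p i * x j - p j * x i\<close>, where \<open>p\<close> is a coordinate vector of \<open>P\<close>; these forms generate the
  homogeneous ideal of \<open>P\<close>.  The blow-up lies in the product of two projective spaces, embedded by
  the Segre map, and the blow-down is the first projection.
\<close>

definition projection_from :: "'i point \<Rightarrow> 'i point \<Rightarrow> ('i \<times> 'i) point" where
  "projection_from P x = {\<lambda>(i, j). p i * v j - p j * v i |p v. p \<in> P \<and> v \<in> x}"

definition standard_blowup :: "'i point set \<Rightarrow> 'i point \<Rightarrow> ('i \<times> 'i \<times> 'i) point set" where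
  "standard_blowup X P = zariski closure_of ((\<lambda>x. segre (x, projection_from P x)) ` (X - {P}))"

definition is_blowup :: "'i point set \<Rightarrow> 'i point \<Rightarrow> 'j point set \<Rightarrow> ('j point \<Rightarrow> 'i point) \<Rightarrow> bool" where
  "is_blowup X P X' \<phi> \<longleftrightarrow> projective_variety X' \<and>
     (\<exists>\<theta>. isomorphism X' (standard_blowup X P) \<theta> \<and> (\<forall>z\<in>X'. \<phi> z = fst (segre_inv (\<theta> z))))"

end

theory Submission
  imports Defs
begin

text \<open>
  Existence: the law on \<open>S'\<close> is again given by a section, namely the strict transform of
  \<open>\<sigma>\<close>, together with \<open>\<pi> \<circ> \<phi>\<close>.  To extend the lift of \<open>\<sigma>\<close> over the point \<open>c\<close> with
  \<open>\<sigma> c = P\<close>, let \<open>t\<close> be a generator of the maximal ideal of \<open>C\<close> at \<open>c\<close>.  In affine coordinates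
  at \<open>P\<close> one has \<open>\<sigma>\<^sub>b - p\<^sub>b = t * r\<^sub>b\<close>, and the direction \<open>r(c)\<close> is nonzero: otherwise
  \<open>\<pi> \<circ> \<sigma> = id\<close> would put \<open>t\<close> into the square of the maximal ideal.  That the
  maximal ideal is principal follows from the Jacobian criterion by Nakayama's lemma.

  Uniqueness: off the exceptional fibre \<open>\<phi>\<close> is injective.  With one argument fixed, two laws are
  morphisms \<open>S' \<rightarrow> S'\<close> that agree on the nonempty open set of points whose product does not lie over \<open>P\<close>,
  hence everywhere, since \<open>S'\<close> is irreducible.
\<close>

section \<open>Points and forms\<close>

text \<open>The blow-up is given as the closure of a graph in a Segre product, without charts: the
  second component over \<open>x\<close> is the wedge of \<open>p\<close> and \<open>x\<close>.
  Lifting the section thus means extending the map sending \<open>c\<close> to the wedge of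
  \<open>p\<close> and \<open>\<sigma> c\<close> across the point where this vector vanishes, which
  calls for dividing out a common factor. Smoothness of the curve provides one. The Jacobian
  criterion speaks of derivatives of forms, while the division happens among germs; a Taylor formula
  with regular coefficients and duality in a finite coordinate space connect the two. Orders of
  vanishing never occur: \<open>t\<close> in the square of the maximal ideal reads t = s * t with
  s(c) = 0, so \<open>t\<close> vanishes near \<open>c\<close> and \<open>c\<close> would be an
  isolated point of the curve. In the uniqueness part, the argument to be varied depends on the law:
  if m(x, y) = x, only the first one moves the product; if m(x, y) = y, only the second one.\<close>

lemma proj_space_mono: "I \<subseteq> J \<Longrightarrow> proj_space I \<subseteq> proj_space J"
  unfolding proj_space_def by auto

lemma proj_space_subset_UNIV: "X \<subseteq> proj_space I \<Longrightarrow> X \<subseteq> proj_space UNIV"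
  using proj_space_mono[OF subset_UNIV] by (rule subset_trans[rotated])

lemma point_scale:
  assumes "x \<in> proj_space I" "v \<in> x" "c \<noteq> 0"
  shows "(\<lambda>i. c * v i) \<in> x"
proof -
  from assms obtain u k where *: "k \<noteq> 0" "v = (\<lambda>i. k * u i)" "x = proj_class u"
    unfolding proj_space_def proj_class_def by blast
  then have "(\<lambda>i. c * v i) = (\<lambda>i. (c * k) * u i)" "c * k \<noteq> 0" using assms by auto
  then show ?thesis using *(3) unfolding proj_class_def by blast
qed

lemma point_proportional:
  assumes "x \<in> proj_space I" "v \<in> x" "w \<in> x"
  obtains c where "c \<noteq> 0" "w = (\<lambda>i. c * v i)"
proof -
  from assms obtain u k l where *: "k \<noteq> 0" "v = (\<lambda>i. k * u i)" "l \<noteq> 0" "w = (\<lambda>i. l * u i)"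
    unfolding proj_space_def proj_class_def by blast
  show thesis by (rule that[of "l / k"]) (use * in auto)
qed

lemma point_nonempty:
  assumes "x \<in> proj_space I"
  obtains v where "v \<in> x"
proof -
  from assms obtain u where "x = proj_class u"
    unfolding proj_space_def by blast
  then have "u \<in> x" unfolding proj_class_def by (auto intro!: exI[of _ 1])
  then show thesis by (rule that)
qed

lemma point_outside: "x \<in> proj_space I \<Longrightarrow> v \<in> x \<Longrightarrow> i \<notin> I \<Longrightarrow> v i = 0"
  unfolding proj_space_def proj_class_def by auto

lemma point_nonzero:
  assumes "x \<in> proj_space I" "v \<in> x"
  obtains i where "i \<in> I" "v i \<noteq> 0"
proof -
  have "v \<noteq> (\<lambda>i. 0)"
    using assms unfolding proj_space_def proj_class_def by (auto simp: fun_eq_iff)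
  then obtain i where "v i \<noteq> 0" by auto
  then show thesis using that point_outside[OF assms] by blast
qed

lemma point_eq_proj_class:
  assumes "x \<in> proj_space I" "v \<in> x"
  shows "x = proj_class v"
proof -
  have "w \<in> x \<longleftrightarrow> w \<in> proj_class v" for w
    using point_scale[OF assms] point_proportional[OF assms] unfolding proj_class_def by blast
  then show ?thesis by blast
qed

lemma point_eqI:
  assumes "x \<in> proj_space I" "y \<in> proj_space J" "v \<in> x" "v \<in> y"
  shows "x = y"
  using point_eq_proj_class[OF assms(1,3)] point_eq_proj_class[OF assms(2,4)] by simp

lemma proj_class_self: "v \<in> proj_class v"
  unfolding proj_class_def by (auto intro!: exI[of _ 1])

lemma proj_class_in_proj_space:
  assumes "v k \<noteq> 0" "\<And>i. i \<notin> I \<Longrightarrow> v i = 0"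
  shows "proj_class v \<in> proj_space I"
proof -
  have "v \<noteq> (\<lambda>i. 0)" using assms(1) by auto
  then show ?thesis unfolding proj_space_def using assms(2) by blast
qed

lemma form_scale: "form d F \<Longrightarrow> F (\<lambda>i. k * u i) = k ^ d * F u"
  by (induction rule: form.induct) (auto simp: algebra_simps power_add)

lemma form_nonzero_point:
  assumes "form d F" "x \<in> proj_space I" "v \<in> x" "F v \<noteq> 0" "w \<in> x"
  shows "F w \<noteq> 0"
proof -
  obtain c where "c \<noteq> 0" "w = (\<lambda>i. c * v i)" using point_proportional[OF assms(2,3,5)] .
  then show ?thesis using form_scale[OF assms(1), of c v] assms(4) by simp
qed

lemma form_power: "form d F \<Longrightarrow> form (n * d) (\<lambda>v. F v ^ n)"
proof (induction n)
  case 0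
  show ?case using form_const[of 1] by simp
next
  case (Suc n)
  then show ?case using form_mult[of d F "n * d" "\<lambda>v. F v ^ n"] by simp
qed

lemma form_coord_power: "form d (\<lambda>v. v i ^ d)"
  using form_power[OF form_coord, of d i] by simp

lemma form_cmult: "form d F \<Longrightarrow> form d (\<lambda>v. c * F v)"
  using form_mult[OF form_const, of d F c] by simp

lemma form_zero: "form d (\<lambda>v. 0)"
  \<comment> \<open>Any form of degree \<open>d\<close> would do here; the power of an arbitrary
    coordinate is one that always exists.\<close>
  using form_cmult[OF form_coord_power[of d undefined], of 0] by simp

lemma form_diff: "form d F \<Longrightarrow> form d G \<Longrightarrow> form d (\<lambda>v. F v - G v)"
  using form_add[of d F, OF _ form_cmult[of d G "-1"]] by simp

lemma form_prod:
  assumes "finite J" "\<And>j. j \<in> J \<Longrightarrow> form (d j) (F j)"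
  shows "form (\<Sum>j\<in>J. d j) (\<lambda>v. \<Prod>j\<in>J. F j v)"
  using assms
proof (induction rule: finite_induct)
  case empty
  show ?case by (simp add: form_const)
next
  case (insert j J)
  then show ?case using form_mult[of "d j" "F j" "\<Sum>j\<in>J. d j" "\<lambda>v. \<Prod>j\<in>J. F j v"] by simp
qed

lemma form_subst:
  assumes "form d G" "\<And>j. form e (F j)"
  shows "form (d * e) (\<lambda>v. G (\<lambda>j. F j v))"
  using assms
proof (induction rule: form.induct)
  case (form_const c)
  show ?case by (simp add: form.form_const)
next
  case (form_coord i)
  then show ?case by simp
next
  case (form_add d F1 F2)
  then show ?case by (simp add: form.form_add)
next
  case (form_mult d F1 e' F2)
  then show ?case by (simp add: add_mult_distrib form.form_mult)
qed

section \<open>The Zariski topology\<close>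

lemma openin_zariski: "openin zariski = zariski_open"
  unfolding zariski_def by (rule topology_inverse'[OF istopology_zariski_open])

lemma topspace_zariski: "topspace zariski = proj_space UNIV"
proof -
  have "zariski_open (proj_space UNIV :: 'a point set)"
  proof -
    have "zero_locus {\<lambda>v. 1} = ({} :: 'a point set)"
    proof -
      have "\<not> (\<forall>v\<in>x. (1::complex) = 0)" if "x \<in> proj_space UNIV" for x :: "'a point"
        using point_nonempty[OF that] by auto
      then show ?thesis unfolding zero_locus_def by auto
    qed
    then show ?thesis
      unfolding zariski_open_def using form_const[of 1] by (intro exI[of _ "{\<lambda>v. 1}"]) auto
  qed
  moreover have "U \<subseteq> proj_space UNIV" if "zariski_open U" for U :: "'a point set"
    using that unfolding zariski_open_def by auto
  ultimately show ?thesis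
    unfolding topspace_def openin_zariski by blast
qed

lemma closedin_zariski_zero_locus:
  assumes "\<And>F. F \<in> T \<Longrightarrow> \<exists>d. form d F"
  shows "closedin zariski (zero_locus T)"
proof -
  have "zero_locus T \<subseteq> proj_space UNIV" unfolding zero_locus_def by blast
  then show ?thesis
    unfolding closedin_def openin_zariski topspace_zariski zariski_open_def using assms by blast
qed

lemma closedin_zariski_eq_zero_locus:
  assumes "closedin zariski X"
  shows "\<exists>T. (\<forall>F\<in>T. \<exists>d. form d F) \<and> X = zero_locus T"
proof -
  from assms obtain T where T: "\<forall>F\<in>T. \<exists>d. form d F" "X \<subseteq> proj_space UNIV"
      "proj_space UNIV - X = proj_space UNIV - zero_locus T"
    unfolding closedin_def openin_zariski topspace_zariski zariski_open_def by blast
  have "zero_locus T \<subseteq> proj_space UNIV" unfolding zero_locus_def by blast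
  then have "X = zero_locus T" using T by blast
  then show ?thesis using T(1) by blast
qed

text \<open>Statements about germs at \<open>x\<close> become \<open>eventually\<close> statements
  along this filter, so that shrinking neighbourhoods is left to
  \<open>eventually_elim\<close>.\<close>

abbreviation nbhd :: "'i point set \<Rightarrow> 'i point \<Rightarrow> 'i point filter" where
  "nbhd X x \<equiv> nhdsin (subtopology zariski X) x"

lemma eventually_nbhd:
  assumes "X \<subseteq> proj_space UNIV" "x \<in> X"
  shows "eventually P (nbhd X x) \<longleftrightarrow> (\<exists>U. openin zariski U \<and> x \<in> U \<and> (\<forall>y\<in>U \<inter> X. P y))"
proof -
  have "x \<in> topspace (subtopology zariski X)" using assms by (auto simp: topspace_zariski)
  then show ?thesis using assms(2)
    unfolding eventually_nhdsin openin_subtopology by auto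
qed

lemma eventually_nbhd_form:
  assumes "X \<subseteq> proj_space UNIV" "x \<in> X" "form d G" "v \<in> x" "G v \<noteq> 0"
  shows "\<forall>\<^sub>F y in nbhd X x. \<forall>v\<in>y. G v \<noteq> 0"
proof -
  let ?U = "proj_space UNIV - zero_locus {G}"
  have "openin zariski ?U" unfolding openin_zariski zariski_open_def using assms(3) by blast
  moreover have "x \<in> ?U" unfolding zero_locus_def using assms by auto
  moreover have "G w \<noteq> 0" if "y \<in> ?U" "w \<in> y" for y w
  proof -
    obtain u where "y \<in> proj_space UNIV" "u \<in> y" "G u \<noteq> 0"
      using \<open>y \<in> ?U\<close> unfolding zero_locus_def by blast
    then show ?thesis using form_nonzero_point[OF assms(3)] \<open>w \<in> y\<close> by blast
  qed
  ultimately show ?thesis unfolding eventually_nbhd[OF assms(1,2)] by blast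
qed

lemma eventually_nbhd_member:
  assumes "X \<subseteq> proj_space UNIV" "x \<in> X"
  shows "\<forall>\<^sub>F y in nbhd X x. y \<in> X"
proof -
  have "x \<in> topspace zariski" using assms by (auto simp: topspace_zariski)
  then show ?thesis unfolding eventually_nbhd[OF assms] by blast
qed

lemma eventually_nbhd_self:
  assumes "eventually P (nbhd X x)" "X \<subseteq> proj_space UNIV" "x \<in> X"
  shows "P x"
  using assms(1,3) unfolding eventually_nbhd[OF assms(2,3)] by blast

section \<open>Morphisms\<close>

lemma morphism_into: "morphism X Y f \<Longrightarrow> x \<in> X \<Longrightarrow> f x \<in> Y"
  unfolding morphism_def by blast

lemma morphism_forms:
  assumes "morphism X Y f" "x \<in> X" "X \<subseteq> proj_space UNIV"
  shows "\<exists>d F. (\<forall>j. form d (F j)) \<and> (\<forall>\<^sub>F y in nbhd X x. \<forall>v\<in>y. (\<lambda>j. F j v) \<in> f y)"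
proof -
  from assms(1,2) obtain U d F where "openin zariski U" "x \<in> U" "\<forall>j. form d (F j)"
      "\<forall>y\<in>U \<inter> X. \<forall>v\<in>y. (\<lambda>j. F j v) \<in> f y"
    unfolding morphism_def by blast
  then show ?thesis unfolding eventually_nbhd[OF assms(3,2)] by blast
qed

lemma morphismI:
  assumes "X \<subseteq> proj_space UNIV" "\<And>x. x \<in> X \<Longrightarrow> f x \<in> Y"
    and "\<And>x. x \<in> X \<Longrightarrow> \<exists>d F. (\<forall>j. form d (F j)) \<and> (\<forall>\<^sub>F y in nbhd X x. \<forall>v\<in>y. (\<lambda>j. F j v) \<in> f y)"
  shows "morphism X Y f"
  unfolding morphism_def
proof (intro conjI ballI)
  show "f ` X \<subseteq> Y" using assms(2) by blast
  fix x assume x: "x \<in> X"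
  from assms(3)[OF this] show "\<exists>U d F. openin zariski U \<and> x \<in> U \<and> (\<forall>j. form d (F j)) \<and>
        (\<forall>y\<in>U \<inter> X. \<forall>v\<in>y. (\<lambda>j. F j v) \<in> f y)"
    unfolding eventually_nbhd[OF assms(1) x] by blast
qed

lemma morphism_cong:
  assumes "morphism X Y f" "\<And>x. x \<in> X \<Longrightarrow> f x = g x"
  shows "morphism X Y g"
proof -
  have "f ` X = g ` X" using assms(2) by auto
  moreover have "(\<forall>y\<in>U \<inter> X. \<forall>v\<in>y. F v \<in> f y) = (\<forall>y\<in>U \<inter> X. \<forall>v\<in>y. F v \<in> g y)" for U F
    using assms(2) by auto
  ultimately show ?thesis using assms(1) unfolding morphism_def by simp
qed

lemma morphism_codomain: "morphism X Y f \<Longrightarrow> (\<And>x. x \<in> X \<Longrightarrow> f x \<in> Z) \<Longrightarrow> morphism X Z f"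
  unfolding morphism_def by blast

lemma morphism_id: "X \<subseteq> proj_space UNIV \<Longrightarrow> morphism X X (\<lambda>x. x)"
proof (rule morphismI)
  fix x
  show "\<exists>d F. (\<forall>j. form d (F j)) \<and> (\<forall>\<^sub>F y in nbhd X x. \<forall>v\<in>y. (\<lambda>j. F j v) \<in> y)"
    by (intro exI[of _ 1] exI[of _ "\<lambda>j v. v j"] conjI allI form_coord) simp
qed

lemma morphism_const:
  assumes "X \<subseteq> proj_space UNIV" "y \<in> Y" "Y \<subseteq> proj_space UNIV"
  shows "morphism X Y (\<lambda>x. y)"
proof -
  obtain w where "w \<in> y" using point_nonempty[OF subsetD[OF assms(3,2)]] .
  have "\<exists>d F. (\<forall>j. form d (F j)) \<and> (\<forall>\<^sub>F z in nbhd X x. \<forall>v\<in>z. (\<lambda>j. F j v) \<in> y)" for x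
    by (intro exI[of _ 0] exI[of _ "\<lambda>j v. w j"] conjI allI form_const) (simp add: \<open>w \<in> y\<close>)
  then show ?thesis using assms by (intro morphismI)
qed

text \<open>Continuity of \<open>f\<close>. Among the equations of the closed complement of a
  neighbourhood of \<open>f x\<close>, one form \<open>G\<close> is nonzero at \<open>f x\<close>;
  substituting the forms that represent \<open>f\<close> into \<open>G\<close> gives a form whose
  nonvanishing defines the required neighbourhood of \<open>x\<close>.\<close>

lemma eventually_morphism:
  assumes "morphism X Y f" "X \<subseteq> proj_space UNIV" "Y \<subseteq> proj_space UNIV" "x \<in> X"
    and "eventually Q (nbhd Y (f x))"
  shows "\<forall>\<^sub>F y in nbhd X x. Q (f y)"
proof -
  have fx: "f x \<in> Y" using assms by (simp add: morphism_into)
  from assms(5) obtain U where U: "openin zariski U" "f x \<in> U" "\<forall>y\<in>U \<inter> Y. Q y"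
    unfolding eventually_nbhd[OF assms(3) fx] by blast
  from U(1) obtain T where T: "\<forall>G\<in>T. \<exists>d. form d G" "U = proj_space UNIV - zero_locus T"
    unfolding openin_zariski zariski_open_def by blast
  from U(2) T(2) obtain G w where G: "G \<in> T" "w \<in> f x" "G w \<noteq> 0"
    unfolding zero_locus_def by blast
  from T(1) G(1) obtain d where d: "form d G" by blast
  obtain e F where F: "\<forall>j. form e (F j)" "\<forall>\<^sub>F y in nbhd X x. \<forall>v\<in>y. (\<lambda>j. F j v) \<in> f y"
    using morphism_forms[OF assms(1,4,2)] by blast
  obtain v where v: "v \<in> x" using point_nonempty[OF subsetD[OF assms(2,4)]] .
  have "(\<lambda>j. F j v) \<in> f x" using eventually_nbhd_self[OF F(2)] assms v by blast
  then have "G (\<lambda>j. F j v) \<noteq> 0" using form_nonzero_point[OF d _ G(2,3)] fx assms(3) by blast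
  from eventually_nbhd_form[OF assms(2,4) form_subst[OF d F(1)[rule_format]] v this]
  have "\<forall>\<^sub>F y in nbhd X x. \<forall>v\<in>y. G (\<lambda>j. F j v) \<noteq> 0" .
  then show ?thesis using F(2) eventually_nbhd_member[OF assms(2,4)]
  proof eventually_elim
    case (elim y)
    obtain u where u: "u \<in> y" using point_nonempty[OF subsetD[OF assms(2) elim(3)]] .
    have fy: "f y \<in> Y" using elim(3) assms(1) by (simp add: morphism_into)
    have "f y \<notin> zero_locus T" using elim u G(1) unfolding zero_locus_def by blast
    then have "f y \<in> U" using fy assms(3) T(2) by blast
    then show ?case using U(3) fy by blast
  qed
qed

lemma morphism_compose:
  assumes f: "morphism X Y f" and g: "morphism Y Z g"
    and "X \<subseteq> proj_space UNIV" "Y \<subseteq> proj_space UNIV"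
  shows "morphism X Z (\<lambda>x. g (f x))"
proof (rule morphismI[OF assms(3)])
  fix x assume x: "x \<in> X"
  show "g (f x) \<in> Z" using f g x by (simp add: morphism_into)
  obtain d F where F: "\<forall>j. form d (F j)" "\<forall>\<^sub>F y in nbhd X x. \<forall>v\<in>y. (\<lambda>j. F j v) \<in> f y"
    using morphism_forms[OF f x assms(3)] by blast
  obtain e G where G: "\<forall>j. form e (G j)" "\<forall>\<^sub>F y in nbhd Y (f x). \<forall>v\<in>y. (\<lambda>j. G j v) \<in> g y"
    using morphism_forms[OF g morphism_into[OF f x] assms(4)] by blast
  show "\<exists>d F. (\<forall>j. form d (F j)) \<and> (\<forall>\<^sub>F y in nbhd X x. \<forall>v\<in>y. (\<lambda>j. F j v) \<in> g (f y))"
  proof (intro exI conjI allI)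
    show "form (e * d) (\<lambda>v. G j (\<lambda>i. F i v))" for j by (rule form_subst[OF G(1)[rule_format] F(1)[rule_format]])
    show "\<forall>\<^sub>F y in nbhd X x. \<forall>v\<in>y. (\<lambda>j. G j (\<lambda>i. F i v)) \<in> g (f y)"
      using F(2) eventually_morphism[OF f assms(3,4) x G(2)] by eventually_elim blast
  qed
qed

text \<open>The forms representing \<open>f\<close> change from point to point, so no global
  equations can be pulled back. Instead the complement is shown to be open around each of its
  points, and closedness of \<open>X\<close> turns closed in \<open>X\<close> into closed.\<close>

lemma closedin_zariski_preimage:
  assumes "morphism X Y f" "closedin zariski X" "Y \<subseteq> proj_space UNIV" "closedin zariski B"
  shows "closedin zariski {x\<in>X. f x \<in> B}"
proof -
  have X: "X \<subseteq> proj_space UNIV" using assms(2) closedin_subset topspace_zariski by blast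
  have "\<exists>V. openin (subtopology zariski X) V \<and> x \<in> V \<and> V \<subseteq> X - {x\<in>X. f x \<in> B}"
    if x: "x \<in> X - {x\<in>X. f x \<in> B}" for x
  proof -
    have "f x \<in> topspace zariski - B" "f x \<in> Y"
      using x assms by (auto simp: topspace_zariski morphism_into)
    moreover have "openin zariski (topspace zariski - B)" using assms(4) by (simp add: closedin_def)
    ultimately have "\<forall>\<^sub>F y in nbhd Y (f x). y \<notin> B"
      using eventually_nbhd[OF assms(3)] by blast
    from eventually_morphism[OF assms(1) X assms(3) _ this] x
    have "\<forall>\<^sub>F y in nbhd X x. f y \<notin> B" by blast
    then show ?thesis using x unfolding openin_subtopology
      by (subst (asm) eventually_nbhd[OF X]) blast+
  qed
  then have "openin (subtopology zariski X) (X - {x\<in>X. f x \<in> B})"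
    using openin_subopen by meson
  then have "closedin (subtopology zariski X) {x\<in>X. f x \<in> B}"
    using X unfolding closedin_def by (simp add: topspace_zariski Int_absorb1)
  then show ?thesis using assms(2) closedin_trans_full by blast
qed

section \<open>The Segre embedding\<close>

lemma segre_member: "v \<in> x \<Longrightarrow> w \<in> y \<Longrightarrow> (\<lambda>(i, j). v i * w j) \<in> segre (x, y)"
  unfolding segre_def prod.case by blast

lemma segre_memberE:
  assumes "u \<in> segre (x, y)"
  obtains v w where "v \<in> x" "w \<in> y" "u = (\<lambda>(i, j). v i * w j)"
proof -
  have "\<exists>v w. u = (\<lambda>(i, j). v i * w j) \<and> v \<in> x \<and> w \<in> y"
    using assms unfolding segre_def prod.case by (rule CollectD)
  then show thesis using that by blast
qed

lemma segre_in_proj_space: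
  assumes "x \<in> proj_space I" "y \<in> proj_space J"
  shows "segre (x, y) \<in> proj_space (I \<times> J)"
proof -
  obtain v where v: "v \<in> x" using assms(1) by (rule point_nonempty)
  obtain w where w: "w \<in> y" using assms(2) by (rule point_nonempty)
  let ?u = "\<lambda>(i, j). v i * w j"
  obtain i where i: "v i \<noteq> 0" using point_nonzero[OF assms(1) v] .
  obtain j where j: "w j \<noteq> 0" using point_nonzero[OF assms(2) w] .
  have "segre (x, y) = proj_class ?u"
  proof (intro equalityI subsetI)
    fix z assume "z \<in> segre (x, y)"
    then obtain v' w' where z: "v' \<in> x" "w' \<in> y" "z = (\<lambda>(i, j). v' i * w' j)"
      by (rule segre_memberE)
    obtain c where c: "c \<noteq> 0" "v' = (\<lambda>i. c * v i)" using point_proportional[OF assms(1) v z(1)] .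
    obtain d where d: "d \<noteq> 0" "w' = (\<lambda>i. d * w i)" using point_proportional[OF assms(2) w z(2)] .
    have "z = (\<lambda>i. (c * d) * ?u i)" unfolding z(3) c(2) d(2) by (simp add: fun_eq_iff)
    moreover have "c * d \<noteq> 0" using c(1) d(1) by simp
    ultimately show "z \<in> proj_class ?u" unfolding proj_class_def by blast
  next
    fix z assume "z \<in> proj_class ?u"
    then obtain c where "c \<noteq> 0" "z = (\<lambda>i. c * ?u i)" unfolding proj_class_def by blast
    then have "z = (\<lambda>(i, j). (c * v i) * w j)" by (simp add: fun_eq_iff)
    then show "z \<in> segre (x, y)"
      using segre_member[OF point_scale[OF assms(1) v \<open>c \<noteq> 0\<close>] w] by simp
  qed
  moreover have "proj_class ?u \<in> proj_space (I \<times> J)"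
  proof (rule proj_class_in_proj_space)
    show "?u (i, j) \<noteq> 0" using i j by simp
    show "?u k = 0" if "k \<notin> I \<times> J" for k
      using that point_outside[OF assms(1) v] point_outside[OF assms(2) w] by (cases k) auto
  qed
  ultimately show ?thesis by simp
qed

text \<open>A point of the Segre image is a matrix of rank one up to scalars; its nonzero columns
  are multiples of \<open>v\<close> and its nonzero rows are multiples of \<open>w\<close>.\<close>

lemma inj_on_segre: "inj_on segre (proj_space UNIV \<times> proj_space UNIV)"
proof (rule inj_onI, clarify)
  fix x x' :: "'a point" and y y' :: "'b point"
  assume p: "x \<in> proj_space UNIV" "y \<in> proj_space UNIV" "x' \<in> proj_space UNIV" "y' \<in> proj_space UNIV"
    and eq: "segre (x, y) = segre (x', y')"
  obtain v where v: "v \<in> x" using p(1) by (rule point_nonempty)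
  obtain w where w: "w \<in> y" using p(2) by (rule point_nonempty)
  obtain i where i: "v i \<noteq> 0" using point_nonzero[OF p(1) v] .
  obtain j where j: "w j \<noteq> 0" using point_nonzero[OF p(2) w] .
  have "(\<lambda>(i, j). v i * w j) \<in> segre (x', y')" using segre_member[OF v w] eq by simp
  then obtain v' w' where *: "v' \<in> x'" "w' \<in> y'" "(\<lambda>(i, j). v i * w j) = (\<lambda>(i, j). v' i * w' j)"
    by (rule segre_memberE)
  then have e: "v k * w l = v' k * w' l" for k l by (auto simp: fun_eq_iff)
  have nz: "v' i \<noteq> 0" "w' j \<noteq> 0" using e[of i j] i j by auto
  have "v = (\<lambda>k. (w' j / w j) * v' k)" using e[of _ j] j by (auto simp: fun_eq_iff field_simps)
  then have v': "v \<in> x'" using point_scale[OF p(3) *(1), of "w' j / w j"] j nz by simp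
  have "w = (\<lambda>k. (v' i / v i) * w' k)" using e[of i] i by (auto simp: fun_eq_iff field_simps)
  then have w': "w \<in> y'" using point_scale[OF p(4) *(2), of "v' i / v i"] i nz by simp
  show "x = x' \<and> y = y'" 
    using point_eqI[OF p(1,3) v v'] point_eqI[OF p(2,4) w w'] by simp
qed

lemma segre_inv_segre:
  "x \<in> proj_space UNIV \<Longrightarrow> y \<in> proj_space UNIV \<Longrightarrow> segre_inv (segre (x, y)) = (x, y)"
  unfolding segre_inv_def using the_inv_into_f_f[OF inj_on_segre, of "(x, y)"] by blast

lemma segre_image_subset:
  assumes "X \<subseteq> proj_space UNIV" "Y \<subseteq> proj_space UNIV"
  shows "segre ` (X \<times> Y) \<subseteq> proj_space UNIV"
proof -
  have "segre (x, y) \<in> proj_space UNIV" if "x \<in> X" "y \<in> Y" for x y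
    using segre_in_proj_space[OF subsetD[OF assms(1) that(1)] subsetD[OF assms(2) that(2)]] by simp
  then show ?thesis by blast
qed

text \<open>Where the entry \<open>(i, j)\<close> is nonzero, column \<open>j\<close> represents the
  first factor and row \<open>i\<close> the second, so linear forms suffice.\<close>

lemma morphism_segre_inv:
  assumes "X \<subseteq> proj_space UNIV" "Y \<subseteq> proj_space UNIV" "Z \<subseteq> segre ` (X \<times> Y)"
  shows "morphism Z X (\<lambda>z. fst (segre_inv z))" "morphism Z Y (\<lambda>z. snd (segre_inv z))"
proof -
  have Z: "Z \<subseteq> proj_space UNIV" using segre_image_subset[OF assms(1,2)] assms(3) by blast
  have inv: "\<exists>x y. z = segre (x, y) \<and> x \<in> X \<and> y \<in> Y \<and> segre_inv z = (x, y)" if "z \<in> Z" for z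
  proof -
    obtain x y where "z = segre (x, y)" "x \<in> X" "y \<in> Y" using \<open>z \<in> Z\<close> assms(3) by blast
    then show ?thesis using segre_inv_segre subsetD[OF assms(1)] subsetD[OF assms(2)] by blast
  qed
  have *: "\<exists>i j. (\<forall>\<^sub>F y in nbhd Z z. \<forall>v\<in>y. v (i, j) \<noteq> 0)" if z: "z \<in> Z" for z
  proof -
    obtain u where u: "u \<in> z" using point_nonempty[OF subsetD[OF Z z]] .
    obtain i j where "u (i, j) \<noteq> 0" 
      using point_nonzero[OF subsetD[OF Z z] u] by (metis surj_pair)
    then show ?thesis using eventually_nbhd_form[OF Z z form_coord u] by blast
  qed
  show "morphism Z X (\<lambda>z. fst (segre_inv z))"
  proof (rule morphismI[OF Z])
    fix z assume z: "z \<in> Z"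
    show "fst (segre_inv z) \<in> X" using inv[OF z] by auto
    obtain i j where ij: "\<forall>\<^sub>F y in nbhd Z z. \<forall>v\<in>y. v (i, j) \<noteq> 0" using *[OF z] by blast
    have "\<forall>\<^sub>F y in nbhd Z z. \<forall>v\<in>y. (\<lambda>k. v (k, j)) \<in> fst (segre_inv y)"
      using ij eventually_nbhd_member[OF Z z]
    proof eventually_elim
      case (elim s)
      obtain x y where xy: "s = segre (x, y)" "x \<in> X" "segre_inv s = (x, y)" using inv elim by blast
      show ?case
      proof
        fix u assume u: "u \<in> s"
        obtain v w where vw: "v \<in> x" "w \<in> y" "u = (\<lambda>(i, j). v i * w j)"
          using u[unfolded xy(1)] by (rule segre_memberE)
        have "w j \<noteq> 0" using elim(1) u vw by fastforce
        then show "(\<lambda>k. u (k, j)) \<in> fst (segre_inv s)"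
          using point_scale[OF subsetD[OF assms(1) xy(2)] vw(1), of "w j"] xy(3) vw(3)
          by (simp add: mult.commute)
      qed
    qed
    then show "\<exists>d F. (\<forall>k. form d (F k)) \<and> (\<forall>\<^sub>F y in nbhd Z z. \<forall>v\<in>y. (\<lambda>k. F k v) \<in> fst (segre_inv y))"
      by (intro exI[of _ 1] exI[of _ "\<lambda>k v. v (k, j)"] conjI allI form_coord)
  qed
  show "morphism Z Y (\<lambda>z. snd (segre_inv z))"
  proof (rule morphismI[OF Z])
    fix z assume z: "z \<in> Z"
    show "snd (segre_inv z) \<in> Y" using inv[OF z] by auto
    obtain i j where ij: "\<forall>\<^sub>F y in nbhd Z z. \<forall>v\<in>y. v (i, j) \<noteq> 0" using *[OF z] by blast
    have "\<forall>\<^sub>F y in nbhd Z z. \<forall>v\<in>y. (\<lambda>k. v (i, k)) \<in> snd (segre_inv y)"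
      using ij eventually_nbhd_member[OF Z z]
    proof eventually_elim
      case (elim s)
      obtain x y where xy: "s = segre (x, y)" "y \<in> Y" "segre_inv s = (x, y)" using inv elim by blast
      show ?case
      proof
        fix u assume u: "u \<in> s"
        obtain v w where vw: "v \<in> x" "w \<in> y" "u = (\<lambda>(i, j). v i * w j)"
          using u[unfolded xy(1)] by (rule segre_memberE)
        have "v i \<noteq> 0" using elim(1) u vw by fastforce
        then show "(\<lambda>k. u (i, k)) \<in> snd (segre_inv s)"
          using point_scale[OF subsetD[OF assms(2) xy(2)] vw(2), of "v i"] xy(3) vw(3) by simp
      qed
    qed
    then show "\<exists>d F. (\<forall>k. form d (F k)) \<and> (\<forall>\<^sub>F y in nbhd Z z. \<forall>v\<in>y. (\<lambda>k. F k v) \<in> snd (segre_inv y))"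
      by (intro exI[of _ 1] exI[of _ "\<lambda>k v. v (i, k)"] conjI allI form_coord)
  qed
qed

lemma morphism_segre:
  assumes f: "morphism X Y f" and g: "morphism X Z g" and X: "X \<subseteq> proj_space UNIV"
  shows "morphism X (segre ` (Y \<times> Z)) (\<lambda>x. segre (f x, g x))"
proof (rule morphismI[OF X])
  fix x assume x: "x \<in> X"
  show "segre (f x, g x) \<in> segre ` (Y \<times> Z)" using morphism_into[OF f x] morphism_into[OF g x] by blast
  obtain d F where F: "\<forall>j. form d (F j)" "\<forall>\<^sub>F y in nbhd X x. \<forall>v\<in>y. (\<lambda>j. F j v) \<in> f y"
    using morphism_forms[OF f x X] by blast
  obtain e G where G: "\<forall>j. form e (G j)" "\<forall>\<^sub>F y in nbhd X x. \<forall>v\<in>y. (\<lambda>j. G j v) \<in> g y"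
    using morphism_forms[OF g x X] by blast
  show "\<exists>d F. (\<forall>j. form d (F j)) \<and> (\<forall>\<^sub>F y in nbhd X x. \<forall>v\<in>y. (\<lambda>j. F j v) \<in> segre (f y, g y))"
  proof (intro exI conjI allI)
    show "form (d + e) ((\<lambda>(i, j) v. F i v * G j v) ij)" for ij
      by (cases ij) (simp add: form_mult[OF F(1)[rule_format] G(1)[rule_format]])
    show "\<forall>\<^sub>F y in nbhd X x. \<forall>v\<in>y. (\<lambda>ij. (\<lambda>(i, j) v. F i v * G j v) ij v) \<in> segre (f y, g y)"
      using F(2) G(2)
    proof eventually_elim
      case (elim y)
      have "(\<lambda>(i, j). F i v * G j v) \<in> segre (f y, g y)" if "v \<in> y" for v
        using segre_member elim that by blast
      then show ?case by (simp add: case_prod_beta')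
    qed
  qed
qed

text \<open>The 2 by 2 minors cut out the matrices of rank one, and the equations of
  \<open>X\<close>, imposed on every column, put the first factor into \<open>X\<close>.\<close>

lemma closedin_zariski_segre_product:
  assumes "closedin zariski X"
  shows "closedin zariski (segre ` (X \<times> (proj_space UNIV :: 'j point set)))"
proof -
  obtain T where T: "\<forall>F\<in>T. \<exists>d. form d F" "X = zero_locus T"
    using closedin_zariski_eq_zero_locus[OF assms] by blast
  define R :: "(('a \<times> 'j \<Rightarrow> complex) \<Rightarrow> complex) set" where
    "R = {(\<lambda>z. z (i, j) * z (k, l) - z (i, l) * z (k, j)) |i j k l. True}
      \<union> {(\<lambda>z. F (\<lambda>i. z (i, j))) |F j. F \<in> T}"
  have hom: "\<exists>d. form d H" if "H \<in> R" for H
  proof -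
    have "form (1 + 1) (\<lambda>z :: 'a \<times> 'j \<Rightarrow> complex. z (i, j) * z (k, l) - z (i, l) * z (k, j))" for i j k l
      by (intro form_diff form_mult form_coord)
    moreover have "\<exists>d. form d (\<lambda>z :: 'a \<times> 'j \<Rightarrow> complex. F (\<lambda>i. z (i, j)))" if F: "F \<in> T" for F j
    proof -
      obtain d where "form d F" using T(1) F by blast
      from form_subst[OF this form_coord, of "\<lambda>i. (i, j)"] show ?thesis by blast
    qed
    ultimately show ?thesis using that unfolding R_def by blast
  qed
  have "segre ` (X \<times> proj_space UNIV) = zero_locus R"
  proof (intro equalityI subsetI)
    fix z assume "z \<in> segre ` (X \<times> (proj_space UNIV :: 'j point set))"
    then obtain x y where xy: "z = segre (x, y)" "x \<in> X" "y \<in> proj_space UNIV" by blast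
    have x: "x \<in> proj_space UNIV" using xy(2) T(2) unfolding zero_locus_def by blast
    have "H u = 0" if H: "H \<in> R" and u: "u \<in> z" for H u
    proof -
      obtain v w where vw: "v \<in> x" "w \<in> y" "u = (\<lambda>(i, j). v i * w j)"
        using u[unfolded xy(1)] by (rule segre_memberE)
      have "F (\<lambda>i. u (i, j)) = 0" if F: "F \<in> T" for F j
      proof -
        obtain d where d: "form d F" using T(1) F by blast
        have "F (\<lambda>i. u (i, j)) = w j ^ d * F v"
          using form_scale[OF d, of "w j" v] vw(3) by (simp add: mult.commute)
        then show ?thesis using xy(2) T(2) F vw(1) unfolding zero_locus_def by auto
      qed
      then show ?thesis using H vw(3) unfolding R_def by auto
    qed
    then show "z \<in> zero_locus R"
      unfolding zero_locus_def using xy(1) segre_in_proj_space[OF x xy(3)] by auto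
  next
    fix z assume z: "z \<in> zero_locus R"
    then have zp: "z \<in> proj_space UNIV" unfolding zero_locus_def by blast
    obtain u where u: "u \<in> z" using zp by (rule point_nonempty)
    obtain i0 j0 where ij: "u (i0, j0) \<noteq> 0" using point_nonzero[OF zp u] by (metis surj_pair)
    have H: "H u = 0" if "H \<in> R" for H using z u that unfolding zero_locus_def by blast
    have rank: "u (i, j) * u (k, l) = u (i, l) * u (k, j)" for i j k l
      using H[of "\<lambda>z. z (i, j) * z (k, l) - z (i, l) * z (k, j)"] unfolding R_def by auto
    \<comment> \<open>The column and the row through the nonzero entry. Dividing the row by that
      entry makes the product of \<open>v\<close> and \<open>w\<close> equal to \<open>u\<close>
      itself and not just to a multiple of it.\<close>
    define v where "v = (\<lambda>i. u (i, j0))"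
    define w where "w = (\<lambda>j. u (i0, j) / u (i0, j0))"
    have v: "proj_class v \<in> proj_space UNIV"
      by (rule proj_class_in_proj_space[of v i0]) (use ij in \<open>auto simp: v_def\<close>)
    have w: "proj_class w \<in> proj_space UNIV"
      by (rule proj_class_in_proj_space[of w j0]) (use ij in \<open>auto simp: w_def\<close>)
    have "u = (\<lambda>(i, j). v i * w j)"
      using rank[of _ _ i0 j0] ij unfolding v_def w_def by (auto simp: fun_eq_iff field_simps)
    then have "u \<in> segre (proj_class v, proj_class w)"
      using segre_member[OF proj_class_self proj_class_self] by metis
    then have zs: "z = segre (proj_class v, proj_class w)"
      using point_eqI[OF zp segre_in_proj_space[OF v w] u] by simp
    have "F v' = 0" if F: "F \<in> T" and v': "v' \<in> proj_class v" for F v'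
    proof -
      obtain d where d: "form d F" using T(1) F by blast
      have "F v = 0" using H[of "\<lambda>z. F (\<lambda>i. z (i, j0))"] F unfolding R_def v_def by blast
      then show ?thesis using v' form_scale[OF d] unfolding proj_class_def by auto
    qed
    then have "proj_class v \<in> X" using v T(2) unfolding zero_locus_def by blast
    then show "z \<in> segre ` (X \<times> proj_space UNIV)" using zs w by blast
  qed
  then show ?thesis using closedin_zariski_zero_locus[of R] hom by simp
qed

text \<open>The diagonal consists of the symmetric matrices of rank one, so the linear equations in
  \<open>T\<close> cut it out of the Segre image; the equalizer is its preimage under the pair of
  \<open>f\<close> and \<open>g\<close>.\<close>

lemma closedin_zariski_equalizer:
  assumes f: "morphism X Y f" and g: "morphism X Y g"
    and X: "closedin zariski X" and Y: "Y \<subseteq> proj_space UNIV"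
  shows "closedin zariski {x\<in>X. f x = g x}"
proof -
  have Xp: "X \<subseteq> proj_space UNIV" using X closedin_subset topspace_zariski by blast
  define T :: "(('b \<times> 'b \<Rightarrow> complex) \<Rightarrow> complex) set" where
    "T = {(\<lambda>z. z (i, j) - z (j, i)) |i j. True}"
  have T: "\<exists>d. form d F" if "F \<in> T" for F
    using that form_diff[OF form_coord form_coord] unfolding T_def by fast
  have "segre (x, y) \<in> zero_locus T \<longleftrightarrow> x = y" 
    if p: "x \<in> proj_space UNIV" "y \<in> proj_space UNIV" for x y
  proof
    assume z: "segre (x, y) \<in> zero_locus T"
    obtain v where v: "v \<in> x" using p(1) by (rule point_nonempty)
    obtain w where w: "w \<in> y" using p(2) by (rule point_nonempty)
    obtain i where i: "v i \<noteq> 0" using point_nonzero[OF p(1) v] .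
    have e: "v j * w k = v k * w j" for j k
      using z segre_member[OF v w] unfolding zero_locus_def T_def by fastforce
    obtain k where k: "w k \<noteq> 0" using point_nonzero[OF p(2) w] .
    have "w i \<noteq> 0" using e[of i k] i k by auto
    moreover have "w = (\<lambda>j. (w i / v i) * v j)" using e[of i] i by (auto simp: fun_eq_iff field_simps)
    ultimately have "w \<in> x" using point_scale[OF p(1) v, of "w i / v i"] i by simp
    then show "x = y" using point_eqI p w by blast
  next
    assume xy: "x = y"
    have "F u = 0" if F: "F \<in> T" and u: "u \<in> segre (x, x)" for F u
    proof -
      obtain v w where vw: "v \<in> x" "w \<in> x" "u = (\<lambda>(i, j). v i * w j)"
        using u by (rule segre_memberE)
      obtain c where "w = (\<lambda>i. c * v i)"
        using point_proportional[OF p(1) vw(1,2)] .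
      then show ?thesis using F vw(3) unfolding T_def by auto
    qed
    then show "segre (x, y) \<in> zero_locus T"
      using xy segre_in_proj_space[OF p] unfolding zero_locus_def by auto
  qed
  then have "{x\<in>X. f x = g x} = {x\<in>X. segre (f x, g x) \<in> zero_locus T}"
    using morphism_into[OF f] morphism_into[OF g] Y by blast
  then show ?thesis
    using closedin_zariski_preimage[OF morphism_segre[OF f g Xp] X segre_image_subset[OF Y Y]
        closedin_zariski_zero_locus[of T]] T by simp
qed

section \<open>Regular functions\<close>

text \<open>Membership of the germ of \<open>f\<close> in the local ring of \<open>X\<close> at
  \<open>x\<close>. Functions stay total and no quotient is formed; values away from
  \<open>x\<close> are unconstrained.\<close>

definition regular :: "'i point set \<Rightarrow> 'i point \<Rightarrow> ('i point \<Rightarrow> complex) \<Rightarrow> bool" where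
  "regular X x f \<longleftrightarrow> (\<exists>d F G. form d F \<and> form d G \<and>
     (\<forall>\<^sub>F y in nbhd X x. \<forall>v\<in>y. G v \<noteq> 0 \<and> f y = F v / G v))"

lemma regularI:
  assumes "form d F" "form d G" "\<forall>\<^sub>F y in nbhd X x. \<forall>v\<in>y. G v \<noteq> 0 \<and> f y = F v / G v"
  shows "regular X x f"
  unfolding regular_def using assms by blast

lemma regular_const: "regular X x (\<lambda>y. c)"
  unfolding regular_def
  by (rule exI[of _ 0], rule exI[of _ "\<lambda>v. c"], rule exI[of _ "\<lambda>v. 1"]) (simp add: form_const)

lemma regular_add:
  assumes "regular X x f" "regular X x g"
  shows "regular X x (\<lambda>y. f y + g y)"
proof -
  obtain d F G where 1: "form d F" "form d G"
    "\<forall>\<^sub>F y in nbhd X x. \<forall>v\<in>y. G v \<noteq> 0 \<and> f y = F v / G v"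
    using assms(1) unfolding regular_def by blast
  obtain d' F' G' where 2: "form d' F'" "form d' G'"
    "\<forall>\<^sub>F y in nbhd X x. \<forall>v\<in>y. G' v \<noteq> 0 \<and> g y = F' v / G' v"
    using assms(2) unfolding regular_def by blast
  have "form (d + d') (\<lambda>v. F v * G' v + G v * F' v)" "form (d + d') (\<lambda>v. G v * G' v)"
    by (intro form_add form_mult 1 2)+
  moreover have "\<forall>\<^sub>F y in nbhd X x. \<forall>v\<in>y. G v * G' v \<noteq> 0 \<and>
      f y + g y = (F v * G' v + G v * F' v) / (G v * G' v)"
    using 1(3) 2(3) by eventually_elim (auto simp: add_frac_eq mult.commute)
  ultimately show ?thesis by (rule regularI)
qed

lemma regular_mult:
  assumes "regular X x f" "regular X x g"
  shows "regular X x (\<lambda>y. f y * g y)"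
proof -
  obtain d F G where 1: "form d F" "form d G"
    "\<forall>\<^sub>F y in nbhd X x. \<forall>v\<in>y. G v \<noteq> 0 \<and> f y = F v / G v"
    using assms(1) unfolding regular_def by blast
  obtain d' F' G' where 2: "form d' F'" "form d' G'"
    "\<forall>\<^sub>F y in nbhd X x. \<forall>v\<in>y. G' v \<noteq> 0 \<and> g y = F' v / G' v"
    using assms(2) unfolding regular_def by blast
  have "form (d + d') (\<lambda>v. F v * F' v)" "form (d + d') (\<lambda>v. G v * G' v)"
    by (intro form_mult 1 2)+
  moreover have "\<forall>\<^sub>F y in nbhd X x. \<forall>v\<in>y. G v * G' v \<noteq> 0 \<and>
      f y * g y = (F v * F' v) / (G v * G' v)"
    using 1(3) 2(3) by eventually_elim auto
  ultimately show ?thesis by (rule regularI)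
qed

lemma regular_diff: "regular X x f \<Longrightarrow> regular X x g \<Longrightarrow> regular X x (\<lambda>y. f y - g y)"
  using regular_add[of X x f, OF _ regular_mult[OF regular_const[of _ _ "-1"], of X x g]] by simp

lemma regular_sum:
  assumes "finite B" "\<And>b. b \<in> B \<Longrightarrow> regular X x (f b)"
  shows "regular X x (\<lambda>y. \<Sum>b\<in>B. f b y)"
  using assms by (induction rule: finite_induct) (simp_all add: regular_const regular_add)

lemma regular_nonzero:
  assumes "X \<subseteq> proj_space UNIV" "x \<in> X" "regular X x f" "f x \<noteq> 0"
  shows "\<forall>\<^sub>F y in nbhd X x. f y \<noteq> 0"
proof -
  obtain d F G where FG: "form d F" "form d G"
    "\<forall>\<^sub>F y in nbhd X x. \<forall>v\<in>y. G v \<noteq> 0 \<and> f y = F v / G v"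
    using assms(3) unfolding regular_def by blast
  obtain v where v: "v \<in> x" using point_nonempty[OF subsetD[OF assms(1,2)]] .
  have "F v \<noteq> 0" using eventually_nbhd_self[OF FG(3) assms(1,2)] v assms(4) by auto
  from eventually_nbhd_form[OF assms(1,2) FG(1) v this] FG(3) eventually_nbhd_member[OF assms(1,2)]
  show ?thesis
  proof eventually_elim
    case (elim y)
    obtain u where "u \<in> y" using point_nonempty[OF subsetD[OF assms(1) elim(3)]] .
    then show ?case using elim by simp
  qed
qed

text \<open>This is what makes the ring of germs local, and it drives the elimination in the
  Nakayama argument below.\<close>

lemma regular_inverse:
  assumes "X \<subseteq> proj_space UNIV" "x \<in> X" "regular X x f" "f x \<noteq> 0"
  shows "regular X x (\<lambda>y. inverse (f y))"
proof -
  obtain d F G where FG: "form d F" "form d G"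
    "\<forall>\<^sub>F y in nbhd X x. \<forall>v\<in>y. G v \<noteq> 0 \<and> f y = F v / G v"
    using assms(3) unfolding regular_def by blast
  have "\<forall>\<^sub>F y in nbhd X x. \<forall>v\<in>y. F v \<noteq> 0 \<and> inverse (f y) = G v / F v"
    using FG(3) regular_nonzero[OF assms] by eventually_elim auto
  then show ?thesis by (rule regularI[OF FG(2,1)])
qed

lemma regular_compose:
  assumes f: "morphism X Y f" and X: "X \<subseteq> proj_space UNIV" and Y: "Y \<subseteq> proj_space UNIV"
    and x: "x \<in> X" and g: "regular Y (f x) g"
  shows "regular X x (\<lambda>y. g (f y))"
proof -
  obtain d F G where FG: "form d F" "form d G"
    "\<forall>\<^sub>F y in nbhd Y (f x). \<forall>v\<in>y. G v \<noteq> 0 \<and> g y = F v / G v"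
    using g unfolding regular_def by blast
  obtain e H where H: "\<forall>j. form e (H j)" "\<forall>\<^sub>F y in nbhd X x. \<forall>v\<in>y. (\<lambda>j. H j v) \<in> f y"
    using morphism_forms[OF f x X] by blast
  have "\<forall>\<^sub>F y in nbhd X x. \<forall>v\<in>y. G (\<lambda>j. H j v) \<noteq> 0 \<and> g (f y) = F (\<lambda>j. H j v) / G (\<lambda>j. H j v)"
    using H(2) eventually_morphism[OF f X Y x FG(3)] by eventually_elim blast
  then show ?thesis
    by (rule regularI[OF form_subst[OF FG(1) H(1)[rule_format]] form_subst[OF FG(2) H(1)[rule_format]]])
qed

text \<open>The ratio does not depend on the chosen vector. Off the chart, where coordinate
  \<open>k\<close> vanishes, division by zero makes it 0.\<close>

definition affine_coord :: "'i \<Rightarrow> 'i \<Rightarrow> 'i point \<Rightarrow> complex" where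
  "affine_coord k i y = (SOME v. v \<in> y) i / (SOME v. v \<in> y) k"

lemma affine_coord_eq:
  assumes "y \<in> proj_space I" "v \<in> y"
  shows "affine_coord k i y = v i / v k"
proof -
  have "(SOME v. v \<in> y) \<in> y" using assms(2) some_in_eq by blast
  then obtain c where "c \<noteq> 0" "(SOME v. v \<in> y) = (\<lambda>i. c * v i)"
    using point_proportional[OF assms] by metis
  then show ?thesis unfolding affine_coord_def by simp
qed

text \<open>This holds off the chart too. There the affine coordinates are all 0: for d > 0 both
  sides are 0, and for d = 0 the form is constant.\<close>

lemma form_affine_coord:
  assumes "y \<in> proj_space I" "v \<in> y" "form d F"
  shows "F (\<lambda>i. affine_coord k i y) = F v / v k ^ d"
proof -
  have "(\<lambda>i. affine_coord k i y) = (\<lambda>i. inverse (v k) * v i)"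
    using affine_coord_eq[OF assms(1,2)] by (simp add: field_simps)
  then show ?thesis using form_scale[OF assms(3), of "inverse (v k)" v]
    by (simp add: field_simps)
qed

lemma affine_coord_in_point:
  assumes "y \<in> proj_space I" "v \<in> y" "v k \<noteq> 0"
  shows "(\<lambda>i. affine_coord k i y) \<in> y"
proof -
  have "(\<lambda>i. affine_coord k i y) = (\<lambda>i. inverse (v k) * v i)"
    using affine_coord_eq[OF assms(1,2)] by (simp add: field_simps)
  then show ?thesis using point_scale[OF assms(1,2), of "inverse (v k)"] assms(3) by simp
qed

lemma regular_form:
  assumes "X \<subseteq> proj_space UNIV" "x \<in> X" "v \<in> x" "v k \<noteq> 0" "form d F"
  shows "regular X x (\<lambda>y. F (\<lambda>i. affine_coord k i y))"
proof -
  have "\<forall>\<^sub>F y in nbhd X x. \<forall>v\<in>y. v k ^ d \<noteq> 0 \<and> F (\<lambda>i. affine_coord k i y) = F v / v k ^ d"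
    using eventually_nbhd_form[OF assms(1,2) form_coord assms(3,4)] eventually_nbhd_member[OF assms(1,2)]
  proof eventually_elim
    case (elim y)
    then show ?case using form_affine_coord[OF subsetD[OF assms(1)] _ assms(5)] by simp
  qed
  then show ?thesis by (rule regularI[OF assms(5) form_coord_power])
qed

lemma regular_affine_coord:
  assumes "X \<subseteq> proj_space UNIV" "x \<in> X" "v \<in> x" "v k \<noteq> 0"
  shows "regular X x (affine_coord k i)"
  using regular_form[OF assms form_coord[of i]] by simp

lemma eventually_affine_coord:
  assumes "X \<subseteq> proj_space UNIV" "x \<in> X" "v \<in> x" "v k \<noteq> 0"
  shows "\<forall>\<^sub>F y in nbhd X x. (\<lambda>i. affine_coord k i y) \<in> y \<and> affine_coord k k y = 1"
  using eventually_nbhd_form[OF assms(1,2) form_coord assms(3,4)] eventually_nbhd_member[OF assms(1,2)]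
proof eventually_elim
  case (elim y)
  have y: "y \<in> proj_space UNIV" using elim(2) assms(1) by blast
  obtain u where u: "u \<in> y" using point_nonempty[OF y] .
  have "u k \<noteq> 0" using elim(1) u by blast
  then show ?case using affine_coord_in_point[OF y u] affine_coord_eq[OF y u] by simp
qed

text \<open>
  The first-order Taylor formula on an affine chart.  The values \<open>q b x\<close> are the partial derivatives
  of \<open>F\<close> at \<open>v\<close>, which links the Jacobian criterion to the maximal ideal at \<open>x\<close>.
\<close>

lemma form_expand:
  assumes "finite I" and X: "X \<subseteq> proj_space I" and x: "x \<in> X" and v: "v \<in> x" and vk: "v k = 1"
    and F: "form d F"
  shows "\<exists>q. (\<forall>b. regular X x (q b)) \<and>
    (\<forall>y\<in>X. F (\<lambda>i. affine_coord k i y) = F v + (\<Sum>b\<in>I. q b y * (affine_coord k b y - v b))) \<and>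
    (\<forall>w. (\<forall>i. i \<notin> I \<longrightarrow> w i = 0) \<longrightarrow>
      ((\<lambda>t. F (\<lambda>i. v i + t * w i)) has_field_derivative (\<Sum>b\<in>I. q b x * w b)) (at 0))"
  using F
proof (induction rule: form.induct)
  case (form_const c)
  show ?case by (rule exI[of _ "\<lambda>b y. 0"]) (simp add: regular_const)
next
  case (form_coord i)
  have out: "affine_coord k i y = 0" if "y \<in> X" "i \<notin> I" for y
  proof -
    have y: "y \<in> proj_space I" using that X by blast
    obtain u where u: "u \<in> y" using point_nonempty[OF y] .
    show ?thesis using affine_coord_eq[OF y u] point_outside[OF y u that(2)] by simp
  qed
  have v0: "v i = 0" if "i \<notin> I" using point_outside[OF subsetD[OF X x] v that] .
  have d: "(\<Sum>b\<in>I. (if b = i then 1 else 0) * c b) = (if i \<in> I then c i else 0)" for c :: "_ \<Rightarrow> complex"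
  proof -
    have "(\<Sum>b\<in>I. (if b = i then 1 else 0) * c b) = (\<Sum>b\<in>I. if b = i then c b else 0)"
      by (rule sum.cong) auto
    then show ?thesis using \<open>finite I\<close> by simp
  qed
  show ?case
  proof (intro exI[of _ "\<lambda>b y. if b = i then 1 else 0"] conjI allI ballI impI)
    show "regular X x (\<lambda>y. if b = i then 1 else 0)" for b by (rule regular_const)
    show "affine_coord k i y = v i + (\<Sum>b\<in>I. (if b = i then 1 else 0) * (affine_coord k b y - v b))"
      if "y \<in> X" for y
      unfolding d using v0 out[OF that] by auto
    show "((\<lambda>t. v i + t * w i) has_field_derivative (\<Sum>b\<in>I. (if b = i then 1 else 0) * w b)) (at 0)"
      if "\<forall>i. i \<notin> I \<longrightarrow> w i = 0" for w
      unfolding d using that by (auto intro!: derivative_eq_intros)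
  qed
next
  case (form_add d F G)
  then obtain q where q: "\<forall>b. regular X x (q b)"
    "\<forall>y\<in>X. F (\<lambda>i. affine_coord k i y) = F v + (\<Sum>b\<in>I. q b y * (affine_coord k b y - v b))"
    "\<forall>w. (\<forall>i. i \<notin> I \<longrightarrow> w i = 0) \<longrightarrow>
      ((\<lambda>t. F (\<lambda>i. v i + t * w i)) has_field_derivative (\<Sum>b\<in>I. q b x * w b)) (at 0)"
    by blast
  from form_add obtain r where r: "\<forall>b. regular X x (r b)"
    "\<forall>y\<in>X. G (\<lambda>i. affine_coord k i y) = G v + (\<Sum>b\<in>I. r b y * (affine_coord k b y - v b))"
    "\<forall>w. (\<forall>i. i \<notin> I \<longrightarrow> w i = 0) \<longrightarrow>
      ((\<lambda>t. G (\<lambda>i. v i + t * w i)) has_field_derivative (\<Sum>b\<in>I. r b x * w b)) (at 0)"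
    by blast
  show ?case
  proof (intro exI[of _ "\<lambda>b y. q b y + r b y"] conjI allI ballI impI)
    show "regular X x (\<lambda>y. q b y + r b y)" for b using q(1) r(1) by (intro regular_add) auto
    show "F (\<lambda>i. affine_coord k i y) + G (\<lambda>i. affine_coord k i y) =
      F v + G v + (\<Sum>b\<in>I. (q b y + r b y) * (affine_coord k b y - v b))" if "y \<in> X" for y
      using q(2) r(2) that by (simp add: distrib_right sum.distrib)
    show "((\<lambda>t. F (\<lambda>i. v i + t * w i) + G (\<lambda>i. v i + t * w i)) has_field_derivative
      (\<Sum>b\<in>I. (q b x + r b x) * w b)) (at 0)" if "\<forall>i. i \<notin> I \<longrightarrow> w i = 0" for w
      using DERIV_add[OF q(3)[rule_format] r(3)[rule_format], of w w] that
      by (simp add: distrib_right sum.distrib)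
  qed
next
  case (form_mult d F e G)
  then obtain q where q: "\<forall>b. regular X x (q b)"
    "\<forall>y\<in>X. F (\<lambda>i. affine_coord k i y) = F v + (\<Sum>b\<in>I. q b y * (affine_coord k b y - v b))"
    "\<forall>w. (\<forall>i. i \<notin> I \<longrightarrow> w i = 0) \<longrightarrow>
      ((\<lambda>t. F (\<lambda>i. v i + t * w i)) has_field_derivative (\<Sum>b\<in>I. q b x * w b)) (at 0)"
    by blast
  from form_mult obtain r where r: "\<forall>b. regular X x (r b)"
    "\<forall>y\<in>X. G (\<lambda>i. affine_coord k i y) = G v + (\<Sum>b\<in>I. r b y * (affine_coord k b y - v b))"
    "\<forall>w. (\<forall>i. i \<notin> I \<longrightarrow> w i = 0) \<longrightarrow>
      ((\<lambda>t. G (\<lambda>i. v i + t * w i)) has_field_derivative (\<Sum>b\<in>I. r b x * w b)) (at 0)"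
    by blast
  have Xu: "X \<subseteq> proj_space UNIV" using proj_space_subset_UNIV[OF X] .
  have Fx: "F (\<lambda>i. affine_coord k i x) = F v"
    using form_affine_coord[OF subsetD[OF X x] v form_mult(1)] vk by simp
  show ?case
  \<comment> \<open>The coefficients come from FG - F(v)G(v) = F * (G - G(v)) + G(v) * (F - F(v));
    at \<open>x\<close>, where \<open>F\<close> takes the value \<open>F v\<close>, they become the
    product rule.\<close>
  proof (intro exI[of _ "\<lambda>b y. F (\<lambda>i. affine_coord k i y) * r b y + G v * q b y"] conjI allI ballI impI)
    show "regular X x (\<lambda>y. F (\<lambda>i. affine_coord k i y) * r b y + G v * q b y)" for b
      using q(1) r(1) regular_form[OF Xu x v _ form_mult(1), of k] vk
      by (intro regular_add regular_mult regular_const) auto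
    show "F (\<lambda>i. affine_coord k i y) * G (\<lambda>i. affine_coord k i y) = F v * G v +
      (\<Sum>b\<in>I. (F (\<lambda>i. affine_coord k i y) * r b y + G v * q b y) * (affine_coord k b y - v b))"
      if "y \<in> X" for y
    proof -
      let ?F = "F (\<lambda>i. affine_coord k i y)" and ?G = "G (\<lambda>i. affine_coord k i y)"
      have "(\<Sum>b\<in>I. (?F * r b y + G v * q b y) * (affine_coord k b y - v b)) =
        ?F * (\<Sum>b\<in>I. r b y * (affine_coord k b y - v b)) + G v * (\<Sum>b\<in>I. q b y * (affine_coord k b y - v b))"
        by (simp add: sum_distrib_left sum.distrib distrib_right mult.assoc)
      also have "\<dots> = ?F * (?G - G v) + G v * (?F - F v)" using q(2) r(2) that by simp
      finally show ?thesis by (simp add: algebra_simps)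
    qed
    show "((\<lambda>t. F (\<lambda>i. v i + t * w i) * G (\<lambda>i. v i + t * w i)) has_field_derivative
      (\<Sum>b\<in>I. (F (\<lambda>i. affine_coord k i x) * r b x + G v * q b x) * w b)) (at 0)"
      if w: "\<forall>i. i \<notin> I \<longrightarrow> w i = 0" for w
    proof -
      have "(\<Sum>b\<in>I. (F (\<lambda>i. affine_coord k i x) * r b x + G v * q b x) * w b) =
        (\<Sum>b\<in>I. q b x * w b) * G v + (\<Sum>b\<in>I. r b x * w b) * F v"
        unfolding Fx by (simp add: sum_distrib_left sum.distrib distrib_right distrib_left mult_ac)
      then show ?thesis using DERIV_mult[OF q(3)[rule_format] r(3)[rule_format], of w w] w by simp
    qed
  qed
qed

text \<open>The functions \<open>affine_coord k b - v b\<close> generate the maximal ideal. With f =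
  F/G, the form F - f(x) * G vanishes at \<open>v\<close>, so its Taylor formula has no constant
  term, and dividing by \<open>G\<close> gives the expansion of f - f(x).\<close>

lemma regular_expand:
  assumes "finite I" and X: "X \<subseteq> proj_space I" and x: "x \<in> X" and v: "v \<in> x" and vk: "v k = 1"
    and f: "regular X x f"
  shows "\<exists>q. (\<forall>b. regular X x (q b)) \<and>
    (\<forall>\<^sub>F y in nbhd X x. f y = f x + (\<Sum>b\<in>I. q b y * (affine_coord k b y - v b)))"
proof -
  have Xu: "X \<subseteq> proj_space UNIV" using proj_space_subset_UNIV[OF X] .
  obtain d F G where FG: "form d F" "form d G"
    "\<forall>\<^sub>F y in nbhd X x. \<forall>v\<in>y. G v \<noteq> 0 \<and> f y = F v / G v"
    using f unfolding regular_def by blast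
  have Gv: "G v \<noteq> 0" "f x = F v / G v" using eventually_nbhd_self[OF FG(3) Xu x] v by auto
  let ?H = "\<lambda>u. F u - f x * G u"
  have "form d ?H" by (intro form_diff form_cmult FG)
  from form_expand[OF assms(1-5) this] obtain q where q: "\<forall>b. regular X x (q b)"
    "\<forall>y\<in>X. ?H (\<lambda>i. affine_coord k i y) = ?H v + (\<Sum>b\<in>I. q b y * (affine_coord k b y - v b))"
    by blast
  have Hv: "?H v = 0" using Gv by simp
  let ?g = "\<lambda>y. inverse (G (\<lambda>i. affine_coord k i y))"
  have vk0: "v k \<noteq> 0" using vk by simp
  have gx: "G (\<lambda>i. affine_coord k i x) \<noteq> 0"
    using form_affine_coord[OF subsetD[OF X x] v FG(2)] vk Gv by simp
  have g: "regular X x ?g"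
    using regular_inverse[OF Xu x regular_form[OF Xu x v vk0 FG(2)] gx] .
  show ?thesis
  proof (intro exI[of _ "\<lambda>b y. ?g y * q b y"] conjI allI)
    show "regular X x (\<lambda>y. ?g y * q b y)" for b using regular_mult[OF g] q(1) by blast
    show "\<forall>\<^sub>F y in nbhd X x. f y = f x + (\<Sum>b\<in>I. ?g y * q b y * (affine_coord k b y - v b))"
      using FG(3) eventually_affine_coord[OF Xu x v vk0] eventually_nbhd_member[OF Xu x]
    proof eventually_elim
      case (elim y)
      let ?a = "\<lambda>i. affine_coord k i y"
      have "(\<Sum>b\<in>I. ?g y * q b y * (affine_coord k b y - v b)) = ?g y * ?H ?a"
        using q(2) elim(3) Hv by (simp add: sum_distrib_left mult.assoc)
      also have "\<dots> = F ?a / G ?a - f x" using elim(1,2) by (simp add: field_simps)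
      also have "\<dots> = f y - f x" using elim(1,2) by auto
      finally show ?case by simp
    qed
  qed
qed

text \<open>
  Instead of inverting the matrix \<open>1 - h\<close>, whose entries \<open>h a b\<close> lie in the maximal ideal, one
  eliminates the generators \<open>z j\<close> one by one.
\<close>

lemma nakayama_elimination:
  assumes X: "X \<subseteq> proj_space UNIV" and x: "x \<in> X" and "finite J"
    and "\<And>a. a \<in> J \<Longrightarrow> regular X x (r a)"
    and "\<And>a b. a \<in> J \<Longrightarrow> b \<in> J \<Longrightarrow> regular X x (h a b) \<and> h a b x = 0"
    and "\<And>a. a \<in> J \<Longrightarrow> \<forall>\<^sub>F y in nbhd X x. z a y = r a y * t y + (\<Sum>b\<in>J. h a b y * z b y)"
    and "a \<in> J"
  shows "\<exists>s. regular X x s \<and> (\<forall>\<^sub>F y in nbhd X x. z a y = s y * t y)"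
  using assms(3-)
proof (induction J arbitrary: r h a rule: finite_induct)
  case empty
  then show ?case by simp
next
  case (insert j J)
  note r = insert.prems(1) and h = insert.prems(2) and eq = insert.prems(3)
  \<comment> \<open>Since \<open>h j j\<close> vanishes at \<open>x\<close>, 1 -
    \<open>h j j\<close> is a unit, so relation \<open>j\<close> can be solved for
    \<open>z j\<close>.\<close>
  define u where "u = (\<lambda>y. inverse (1 - h j j y))"
  have u: "regular X x u"
    unfolding u_def using h[of j j] by (intro regular_inverse X x regular_diff regular_const) auto
  have ux: "\<forall>\<^sub>F y in nbhd X x. 1 - h j j y \<noteq> 0"
    using h[of j j] by (intro regular_nonzero X x regular_diff regular_const) auto
  have zj: "\<forall>\<^sub>F y in nbhd X x. z j y = u y * r j y * t y + (\<Sum>b\<in>J. u y * h j b y * z b y)"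
    using ux eq[OF insertI1]
  proof eventually_elim
    case (elim y)
    have "(1 - h j j y) * z j y = r j y * t y + (\<Sum>b\<in>J. h j b y * z b y)"
      using elim(2) insert.hyps by (simp add: algebra_simps)
    then have "z j y = u y * (r j y * t y + (\<Sum>b\<in>J. h j b y * z b y))"
      using elim(1) unfolding u_def by (simp add: field_simps)
    then show ?case by (simp add: distrib_left sum_distrib_left mult.assoc)
  qed
  have J: "\<exists>s. regular X x s \<and> (\<forall>\<^sub>F y in nbhd X x. z a y = s y * t y)" if a: "a \<in> J" for a
  \<comment> \<open>The coefficients left after substituting the solved expression for
    \<open>z j\<close>. The new matrix entries still vanish at \<open>x\<close>, because
    \<open>h a b\<close> and \<open>h a j\<close> do.\<close>
  proof (rule insert.IH[where r = "\<lambda>a y. r a y + h a j y * (u y * r j y)"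
        and h = "\<lambda>a b y. h a b y + h a j y * (u y * h j b y)"])
    show "regular X x (\<lambda>y. r a y + h a j y * (u y * r j y))" if "a \<in> J" for a
      using r h u that by (intro regular_add regular_mult) auto
    show "regular X x (\<lambda>y. h a b y + h a j y * (u y * h j b y)) \<and> h a b x + h a j x * (u x * h j b x) = 0"
      if "a \<in> J" "b \<in> J" for a b
      using h u that by (auto intro!: regular_add regular_mult)
    show "\<forall>\<^sub>F y in nbhd X x. z a y = (r a y + h a j y * (u y * r j y)) * t y +
        (\<Sum>b\<in>J. (h a b y + h a j y * (u y * h j b y)) * z b y)" if "a \<in> J" for a
      using zj eq[OF insertI2[OF that]]
    proof eventually_elim
      case (elim y)
      have "z a y = r a y * t y + h a j y * z j y + (\<Sum>b\<in>J. h a b y * z b y)"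
        using elim(2) insert.hyps by simp
      also have "h a j y * z j y = h a j y * (u y * r j y) * t y + (\<Sum>b\<in>J. h a j y * (u y * h j b y) * z b y)"
        unfolding elim(1) by (simp add: distrib_left sum_distrib_left mult.assoc)
      finally show ?case by (simp add: distrib_right sum.distrib)
    qed
  qed (rule a)
  show ?case
  proof (cases "a = j")
    case False
    then show ?thesis using J insert.prems(4) by blast
  next
    case True
    \<comment> \<open>Back-substitution: the other generators are multiples of \<open>t\<close> by
      now, hence so is \<open>z j\<close>.\<close>
    obtain s where s: "\<forall>a\<in>J. regular X x (s a) \<and> (\<forall>\<^sub>F y in nbhd X x. z a y = s a y * t y)"
      using J by metis
    then have "\<forall>\<^sub>F y in nbhd X x. \<forall>a\<in>J. z a y = s a y * t y"
      using insert.hyps(1) by (simp add: eventually_ball_finite_distrib)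
    with zj have "\<forall>\<^sub>F y in nbhd X x. z j y = (u y * r j y + (\<Sum>b\<in>J. u y * h j b y * s b y)) * t y"
    proof eventually_elim
      case (elim y)
      then show ?case by (simp add: distrib_right sum_distrib_right mult.assoc)
    qed
    moreover have "regular X x (\<lambda>y. u y * r j y + (\<Sum>b\<in>J. u y * h j b y * s b y))"
      using s u r h insert.hyps(1) by (intro regular_add regular_mult regular_sum) auto
    ultimately show ?thesis using True by blast
  qed
qed

text \<open>A basis of \<open>W\<close> stays independent when \<open>e\<close> is added, so some
  linear functional vanishes on \<open>W\<close> and is 1 at \<open>e\<close>. As \<open>I\<close>
  is finite, its values on the unit vectors represent it by a coordinate vector.\<close>

lemma subspace_separation:
  fixes W :: "('i \<Rightarrow> complex) set"
  assumes "finite I" "cfun.subspace W" and W: "\<forall>c\<in>W. \<forall>i. i \<notin> I \<longrightarrow> c i = 0"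
    and e: "e \<notin> W" "\<forall>i. i \<notin> I \<longrightarrow> e i = 0"
  shows "\<exists>z. (\<forall>i. i \<notin> I \<longrightarrow> z i = 0) \<and> (\<forall>c\<in>W. (\<Sum>i\<in>I. c i * z i) = 0) \<and>
    (\<Sum>i\<in>I. e i * z i) = 1"
proof -
  interpret vp: vector_space_pair "fun_scale :: complex \<Rightarrow> ('i \<Rightarrow> complex) \<Rightarrow> _" "(*) :: complex \<Rightarrow> complex \<Rightarrow> complex"
    by unfold_locales (auto simp: algebra_simps)
  obtain B where B: "B \<subseteq> W" "cfun.independent B" "W \<subseteq> cfun.span B"
    using cfun.basis_exists by metis
  have sB: "cfun.span B = W" using B cfun.span_minimal[OF B(1) assms(2)] by blast
  then have "cfun.independent (insert e B)" using cfun.independent_insertI[of e B] e B(2) by blast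
  from vp.linear_independent_extend[OF this, of "\<lambda>x. if x = e then 1 else 0"]
  obtain g where g: "Vector_Spaces.linear fun_scale (*) g"
    "\<forall>x\<in>insert e B. g x = (if x = e then 1 else 0)" by blast
  have "e \<notin> B" using B(1) e(1) by blast
  then have gB: "g b = 0" if "b \<in> B" for b using g(2) that by auto
  have gW: "g c = 0" if "c \<in> W" for c
    using vp.linear_eq_0_on_span[OF g(1) gB] that sB by blast
  define \<delta> :: "'i \<Rightarrow> 'i \<Rightarrow> complex" where "\<delta> = (\<lambda>i j. if j = i then 1 else 0)"
  define z where "z = (\<lambda>i. if i \<in> I then g (\<delta> i) else 0)"
  have gz: "g c = (\<Sum>i\<in>I. c i * z i)" if "\<And>i. i \<notin> I \<Longrightarrow> c i = 0" for c
  proof -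
    have "(\<Sum>i\<in>J. fun_scale (c i) (\<delta> i)) j = (if j \<in> J then c j else 0)" if "finite J" for J j
      using that by (induction rule: finite_induct) (auto simp: \<delta>_def fun_scale_def)
    then have "c = (\<Sum>i\<in>I. fun_scale (c i) (\<delta> i))" using that assms(1) by (auto simp: fun_eq_iff)
    then have "g c = g (\<Sum>i\<in>I. fun_scale (c i) (\<delta> i))" by simp
    also have "\<dots> = (\<Sum>i\<in>I. g (fun_scale (c i) (\<delta> i)))" by (rule vp.linear_sum[OF g(1)])
    also have "\<dots> = (\<Sum>i\<in>I. c i * g (\<delta> i))" by (simp add: vp.linear_scale[OF g(1)])
    finally show ?thesis by (simp add: z_def)
  qed
  show ?thesis
  proof (intro exI[of _ z] conjI allI ballI impI)
    show "z i = 0" if "i \<notin> I" for i using that by (simp add: z_def)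
    show "(\<Sum>i\<in>I. c i * z i) = 0" if "c \<in> W" for c using gz[of c] W that gW[OF that] by simp
    show "(\<Sum>i\<in>I. e i * z i) = 1" using gz[of e] e(2) g(2) by simp
  qed
qed

section \<open>A uniformizer at a smooth point of a curve\<close>

text \<open>The annihilator \<open>K\<close> of \<open>W\<close> is at most a line: it lies in the
  tangent space of the cone and is transversal to the radial direction \<open>v\<close>, which takes
  up one of the two dimensions. Dually \<open>W\<close> has codimension at most one, so modulo the
  square of the maximal ideal every \<open>z a\<close> is a multiple of one \<open>z a0\<close>.
  Nakayama turns this congruence into an equation of germs, with \<open>z a0\<close> as the
  uniformizer.\<close>

lemma uniformizer:
  fixes X :: "'i point set"
  assumes fin: "finite I" and X: "X \<subseteq> proj_space I" and x: "x \<in> X" and v: "v \<in> x" and vk: "v k = 1"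
    and dim: "cfun.dim (cone_tangent_space X v) = 2"
  shows "\<exists>t. regular X x t \<and> t x = 0 \<and> (\<forall>f. regular X x f \<and> f x = 0 \<longrightarrow>
    (\<exists>r. regular X x r \<and> (\<forall>\<^sub>F y in nbhd X x. f y = r y * t y)))"
proof -
  define z where "z = (\<lambda>b y. affine_coord k b y - v b)"
  have Xu: "X \<subseteq> proj_space UNIV" using proj_space_subset_UNIV[OF X] .
  have xI: "x \<in> proj_space I" using x X by blast
  have vk0: "v k \<noteq> 0" using vk by simp
  have kI: "k \<in> I" using point_outside[OF xI v] vk0 by blast
  have zx: "z b x = 0" for b unfolding z_def using affine_coord_eq[OF xI v] vk by simp
  have zr: "regular X x (z b)" for b
    unfolding z_def by (intro regular_diff regular_const regular_affine_coord[OF Xu x v vk0])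
  \<comment> \<open>the linear forms in the \<open>z b\<close> lying in the square of the maximal ideal, and their annihilator \<open>K\<close>\<close>
  define W where "W = {c. (\<forall>i. i \<notin> I \<longrightarrow> c i = 0) \<and> (\<exists>h. (\<forall>b. regular X x (h b) \<and> h b x = 0) \<and>
    (\<forall>\<^sub>F y in nbhd X x. (\<Sum>b\<in>I. c b * z b y) = (\<Sum>b\<in>I. h b y * z b y)))}"
  have W_out: "c i = 0" if "c \<in> W" "i \<notin> I" for c i using that unfolding W_def by blast
  have W: "cfun.subspace W"
  proof (rule cfun.subspaceI)
    show "0 \<in> W" unfolding W_def
      by (auto intro!: exI[of _ "\<lambda>b y. 0"] regular_const)
  next
    fix c d assume c: "c \<in> W" and d: "d \<in> W"
    obtain h where h: "\<forall>b. regular X x (h b) \<and> h b x = 0"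
      "\<forall>\<^sub>F y in nbhd X x. (\<Sum>b\<in>I. c b * z b y) = (\<Sum>b\<in>I. h b y * z b y)"
      using c unfolding W_def by blast
    obtain g where g: "\<forall>b. regular X x (g b) \<and> g b x = 0"
      "\<forall>\<^sub>F y in nbhd X x. (\<Sum>b\<in>I. d b * z b y) = (\<Sum>b\<in>I. g b y * z b y)"
      using d unfolding W_def by blast
    have "\<forall>\<^sub>F y in nbhd X x. (\<Sum>b\<in>I. (c + d) b * z b y) = (\<Sum>b\<in>I. (h b y + g b y) * z b y)"
      using h(2) g(2) by eventually_elim (simp add: distrib_right sum.distrib)
    moreover have "\<forall>b. regular X x (\<lambda>y. h b y + g b y) \<and> h b x + g b x = 0"
      using h(1) g(1) by (intro allI conjI regular_add) auto
    moreover have "\<forall>i. i \<notin> I \<longrightarrow> (c + d) i = 0" using W_out[OF c] W_out[OF d] by simp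
    ultimately show "c + d \<in> W" unfolding W_def by (intro CollectI conjI exI[of _ "\<lambda>b y. h b y + g b y"])
  next
    fix s c assume c: "c \<in> W"
    obtain h where h: "\<forall>b. regular X x (h b) \<and> h b x = 0"
      "\<forall>\<^sub>F y in nbhd X x. (\<Sum>b\<in>I. c b * z b y) = (\<Sum>b\<in>I. h b y * z b y)"
      using c unfolding W_def by blast
    have "\<forall>\<^sub>F y in nbhd X x. (\<Sum>b\<in>I. fun_scale s c b * z b y) = (\<Sum>b\<in>I. (s * h b y) * z b y)"
      using h(2) by eventually_elim (simp add: fun_scale_def sum_distrib_left[symmetric] mult.assoc)
    moreover have "\<forall>b. regular X x (\<lambda>y. s * h b y) \<and> s * h b x = 0"
      using h(1) by (intro allI conjI regular_mult regular_const) auto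
    moreover have "\<forall>i. i \<notin> I \<longrightarrow> fun_scale s c i = 0" using W_out[OF c] by (simp add: fun_scale_def)
    ultimately show "fun_scale s c \<in> W" unfolding W_def by (intro CollectI conjI exI[of _ "\<lambda>b y. s * h b y"])
  qed
  define K where "K = (\<lambda>w. (\<forall>i. i \<notin> I \<longrightarrow> w i = 0) \<and> (\<forall>c\<in>W. (\<Sum>i\<in>I. c i * w i) = 0))"
  have K_sum: "(\<Sum>i\<in>I. c i * w i) = 0" if "K w" "c \<in> W" for c w
    using that unfolding K_def by blast
  have K_tangent: "w \<in> cone_tangent_space X v" if w: "K w" for w
  proof -
    have "deriv (\<lambda>t. F (\<lambda>i. v i + t * w i)) 0 = 0" if F: "form d F" and F0: "\<forall>u\<in>\<Union>X. F u = 0" for d F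
    proof -
      obtain q where q: "\<forall>b. regular X x (q b)"
        "\<forall>y\<in>X. F (\<lambda>i. affine_coord k i y) = F v + (\<Sum>b\<in>I. q b y * (affine_coord k b y - v b))"
        "\<forall>w. (\<forall>i. i \<notin> I \<longrightarrow> w i = 0) \<longrightarrow>
          ((\<lambda>t. F (\<lambda>i. v i + t * w i)) has_field_derivative (\<Sum>b\<in>I. q b x * w b)) (at 0)"
        using form_expand[OF fin X x v vk F] by blast
      have Fv: "F v = 0" using F0 v x by blast
      \<comment> \<open>The gradient of \<open>F\<close> at \<open>v\<close> lies in
        \<open>W\<close>: as \<open>F\<close> vanishes on \<open>X\<close>, the sum of the
        \<open>q b * z b\<close> is 0 near \<open>x\<close>, and replacing each \<open>q b\<close>
        by its value at \<open>x\<close> leaves the coefficients \<open>q b x - q b\<close>, which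
        vanish at \<open>x\<close>.\<close>
      define c where "c = (\<lambda>b. if b \<in> I then q b x else 0)"
      have "\<forall>\<^sub>F y in nbhd X x. (\<Sum>b\<in>I. c b * z b y) = (\<Sum>b\<in>I. (q b x - q b y) * z b y)"
        using eventually_affine_coord[OF Xu x v vk0] eventually_nbhd_member[OF Xu x]
      proof eventually_elim
        case (elim y)
        have "F (\<lambda>i. affine_coord k i y) = 0" using F0 elim by blast
        then have "(\<Sum>b\<in>I. q b y * z b y) = 0" using q(2) elim(2) Fv unfolding z_def by simp
        then show ?case by (simp add: c_def left_diff_distrib sum_subtractf)
      qed
      moreover have "\<forall>b. regular X x (\<lambda>y. q b x - q b y) \<and> q b x - q b x = 0"
        using q(1) by (intro allI conjI regular_diff regular_const) auto
      ultimately have "c \<in> W" unfolding W_def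
        by (intro CollectI conjI exI[of _ "\<lambda>b y. q b x - q b y"]) (auto simp: c_def)
      then have "(\<Sum>b\<in>I. c b * w b) = 0" using K_sum[OF w] by blast
      then have "(\<Sum>b\<in>I. q b x * w b) = 0" by (simp add: c_def)
      then have "((\<lambda>t. F (\<lambda>i. v i + t * w i)) has_field_derivative 0) (at 0)"
        using q(3)[rule_format, of w] w unfolding K_def by simp
      then show ?thesis by (rule DERIV_imp_deriv)
    qed
    then show ?thesis unfolding cone_tangent_space_def by blast
  qed
  \<comment> \<open>Euler's relation: moving along \<open>v\<close> only rescales the vector, so
    forms vanishing on the cone stay zero.\<close>
  have v_tangent: "v \<in> cone_tangent_space X v"
  proof -
    have "deriv (\<lambda>t. F (\<lambda>i. v i + t * v i)) 0 = 0" if F: "form d F" and F0: "\<forall>u\<in>\<Union>X. F u = 0" for d F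
    proof -
      have "F (\<lambda>i. v i + t * v i) = 0" for t
      proof -
        have "(\<lambda>i. v i + t * v i) = (\<lambda>i. (1 + t) * v i)" by (simp add: distrib_right)
        moreover have "F v = 0" using F0 v x by blast
        ultimately show ?thesis using form_scale[OF F, of "1 + t" v] by simp
      qed
      then show ?thesis by simp
    qed
    then show ?thesis unfolding cone_tangent_space_def by blast
  qed
  have \<delta>: "(\<Sum>i\<in>I. (if i = a then 1 else 0) * f i) = f a" if "a \<in> I" for a and f :: "'i \<Rightarrow> complex"
  proof -
    have "(\<Sum>i\<in>I. (if i = a then 1 else 0) * f i) = (\<Sum>i\<in>I. if i = a then f i else 0)"
      by (rule sum.cong) auto
    then show ?thesis using fin that by simp
  qed
  \<comment> \<open>In the chart \<open>z k\<close> is 0, so the unit vector at \<open>k\<close>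
    belongs to \<open>W\<close>. Hence \<open>K\<close> misses \<open>v\<close>, whose coordinate
    \<open>k\<close> is 1.\<close>
  have K_k: "w k = 0" if w: "K w" for w
  proof -
    have "\<forall>\<^sub>F y in nbhd X x. (\<Sum>b\<in>I. (if b = k then 1 else 0) * z b y) = (\<Sum>b\<in>I. 0 * z b y)"
      using eventually_affine_coord[OF Xu x v vk0]
    proof eventually_elim
      case (elim y)
      have "z k y = 0" unfolding z_def using elim vk by simp
      then show ?case unfolding \<delta>[OF kI] by simp
    qed
    then have "(\<lambda>i. if i = k then 1 else 0) \<in> W" unfolding W_def
      using kI by (intro CollectI conjI exI[of _ "\<lambda>b y. 0"]) (auto intro: regular_const)
    from K_sum[OF w this] show ?thesis unfolding \<delta>[OF kI] .
  qed
  \<comment> \<open>Two independent vectors of \<open>K\<close> together with \<open>v\<close> would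
    be three independent vectors in a space of dimension 2.\<close>
  have K_line: "\<exists>s. u = (\<lambda>i. s * w i)" if w: "K w" and w0: "w \<noteq> 0" and u: "K u" for w u
  proof (rule ccontr)
    assume n: "\<not> ?thesis"
    have "cfun.independent {w}" using w0 by (simp add: cfun.dependent_single)
    moreover have "u \<notin> cfun.span {w}"
      using n unfolding cfun.span_singleton fun_scale_def by blast
    ultimately have uw: "cfun.independent {u, w}" using cfun.independent_insertI by blast
    have "cfun.span {u, w} \<subseteq> {f. f k = 0}"
    proof (rule cfun.span_minimal)
      show "{u, w} \<subseteq> {f. f k = 0}" using K_k w u by blast
      show "cfun.subspace {f. f k = 0}" by (rule cfun.subspaceI) (auto simp: fun_scale_def)
    qed
    then have "v \<notin> cfun.span {u, w}" using vk0 by blast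
    then have ind: "cfun.independent {v, u, w}" using uw cfun.independent_insertI by blast
    obtain B where B: "cone_tangent_space X v \<subseteq> cfun.span B" "card B = 2"
      using cfun.basis_exists dim by metis
    have "finite B" using B(2) card.infinite by fastforce
    moreover have "{v, u, w} \<subseteq> cfun.span B" using B(1) v_tangent K_tangent[OF w] K_tangent[OF u] by blast
    ultimately have "card {v, u, w} \<le> 2" using cfun.independent_span_bound[OF _ ind] B(2) by metis
    moreover have "v \<noteq> u" "v \<noteq> w" using K_k[OF w] K_k[OF u] vk0 by auto
    moreover have "u \<noteq> w" using \<open>u \<notin> cfun.span {w}\<close> cfun.span_base[of w "{w}"] by auto
    ultimately show False by simp
  qed
  \<comment> \<open>On \<open>K\<close> all coordinates are proportional to coordinate
    \<open>a0\<close>, so each difference of unit vectors below is annihilated by \<open>K\<close>.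
    By separation, a vector that \<open>K\<close> annihilates must lie in \<open>W\<close>.\<close>
  have "\<exists>a0 c. a0 \<in> I \<and> (\<forall>a\<in>I. (\<lambda>i. (if i = a then 1 else 0) - c a * (if i = a0 then 1 else 0)) \<in> W)"
  proof -
    have "\<exists>a0 c. a0 \<in> I \<and> (\<forall>u. K u \<longrightarrow> (\<forall>a\<in>I. u a = c a * u a0))"
    proof (cases "\<exists>w. K w \<and> w \<noteq> 0")
      case False
      \<comment> \<open>If \<open>K\<close> is trivial, every unit vector lies in \<open>W\<close>;
        then \<open>a0 = k\<close> serves with all coefficients 0.\<close>
      then have "\<forall>u. K u \<longrightarrow> (\<forall>a\<in>I. u a = 0 * u k)" by auto
      then show ?thesis by (intro exI[of _ k] exI[of _ "\<lambda>a. 0"] conjI kI)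
    next
      case True
      then obtain w where w: "K w" "w \<noteq> 0" by blast
      from w(2) obtain a0 where a0: "w a0 \<noteq> 0" by (auto simp: fun_eq_iff)
      then have "a0 \<in> I" using w(1) unfolding K_def by blast
      moreover have "u a = w a / w a0 * u a0" if "K u" for u a
        using K_line[OF w that] a0 by auto
      ultimately show ?thesis by (intro exI[of _ a0] exI[of _ "\<lambda>a. w a / w a0"]) blast
    qed
    then obtain a0 c where a0: "a0 \<in> I" and c: "\<And>u a. K u \<Longrightarrow> a \<in> I \<Longrightarrow> u a = c a * u a0" by blast
    have "(\<lambda>i. (if i = a then 1 else 0) - c a * (if i = a0 then 1 else 0)) \<in> W" if a: "a \<in> I" for a
    proof (rule ccontr)
      let ?e = "\<lambda>i. (if i = a then 1 else 0) - c a * (if i = a0 then 1 else 0) :: complex"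
      assume n: "?e \<notin> W"
      have "\<forall>i. i \<notin> I \<longrightarrow> ?e i = 0" using a a0 by auto
      moreover have "\<forall>c\<in>W. \<forall>i. i \<notin> I \<longrightarrow> c i = 0" using W_out by blast
      ultimately obtain u where u: "\<forall>i. i \<notin> I \<longrightarrow> u i = 0" "\<forall>c\<in>W. (\<Sum>i\<in>I. c i * u i) = 0"
        "(\<Sum>i\<in>I. ?e i * u i) = 1"
        using subspace_separation[OF fin W _ n] by blast
      have "K u" unfolding K_def using u(1,2) by blast
      moreover have "(\<Sum>i\<in>I. ((if i = a then 1 else 0) - c a * (if i = a0 then 1 else 0)) * u i) =
        (\<Sum>i\<in>I. (if i = a then 1 else 0) * u i) - c a * (\<Sum>i\<in>I. (if i = a0 then 1 else 0) * u i)"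
        unfolding left_diff_distrib sum_subtractf mult.assoc sum_distrib_left ..
      ultimately show False using u(3) c[of u a] a unfolding \<delta>[OF a] \<delta>[OF a0] by simp
    qed
    then show ?thesis using a0 by blast
  qed
  then obtain a0 c where a0: "a0 \<in> I"
    and c: "\<forall>a\<in>I. (\<lambda>i. (if i = a then 1 else 0) - c a * (if i = a0 then 1 else 0)) \<in> W" by blast
  have "\<forall>a\<in>I. \<exists>h. (\<forall>b. regular X x (h b) \<and> h b x = 0) \<and>
    (\<forall>\<^sub>F y in nbhd X x. z a y = c a * z a0 y + (\<Sum>b\<in>I. h b y * z b y))"
  proof
    fix a assume a: "a \<in> I"
    obtain h where h: "\<forall>b. regular X x (h b) \<and> h b x = 0"
      "\<forall>\<^sub>F y in nbhd X x. (\<Sum>i\<in>I. ((if i = a then 1 else 0) - c a * (if i = a0 then 1 else 0)) * z i y)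
        = (\<Sum>b\<in>I. h b y * z b y)"
      using c a unfolding W_def by blast
    have "\<forall>\<^sub>F y in nbhd X x. z a y = c a * z a0 y + (\<Sum>b\<in>I. h b y * z b y)"
      using h(2)
    proof eventually_elim
      case (elim y)
      have "(\<Sum>i\<in>I. ((if i = a then 1 else 0) - c a * (if i = a0 then 1 else 0)) * z i y) =
        (\<Sum>i\<in>I. (if i = a then 1 else 0) * z i y) - c a * (\<Sum>i\<in>I. (if i = a0 then 1 else 0) * z i y)"
        unfolding left_diff_distrib sum_subtractf mult.assoc sum_distrib_left ..
      then show ?case using elim unfolding \<delta>[OF a] \<delta>[OF a0] by simp
    qed
    then show "\<exists>h. (\<forall>b. regular X x (h b) \<and> h b x = 0) \<and>
      (\<forall>\<^sub>F y in nbhd X x. z a y = c a * z a0 y + (\<Sum>b\<in>I. h b y * z b y))" using h(1) by blast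
  qed
  from bchoice[OF this] obtain h where h: "\<forall>a\<in>I. (\<forall>b. regular X x (h a b) \<and> h a b x = 0) \<and>
    (\<forall>\<^sub>F y in nbhd X x. z a y = c a * z a0 y + (\<Sum>b\<in>I. h a b y * z b y))"
    by (rule exE)
  have "\<forall>a\<in>I. \<exists>s. regular X x s \<and> (\<forall>\<^sub>F y in nbhd X x. z a y = s y * z a0 y)"
  proof
    fix a assume a: "a \<in> I"
    show "\<exists>s. regular X x s \<and> (\<forall>\<^sub>F y in nbhd X x. z a y = s y * z a0 y)"
    proof (rule nakayama_elimination[OF Xu x fin, where r = "\<lambda>a y. c a" and h = h])
      show "regular X x (\<lambda>y. c a)" for a by (rule regular_const)
      show "regular X x (h a b) \<and> h a b x = 0" if "a \<in> I" for a b using h that by blast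
      show "\<forall>\<^sub>F y in nbhd X x. z a y = c a * z a0 y + (\<Sum>b\<in>I. h a b y * z b y)" if "a \<in> I" for a
        using h that by blast
    qed (rule a)
  qed
  from bchoice[OF this] obtain s where
    s: "\<forall>a\<in>I. regular X x (s a) \<and> (\<forall>\<^sub>F y in nbhd X x. z a y = s a y * z a0 y)"
    by (rule exE)
  then have s_ev: "\<forall>\<^sub>F y in nbhd X x. \<forall>a\<in>I. z a y = s a y * z a0 y"
    using fin by (simp add: eventually_ball_finite_distrib)
  have "\<exists>r. regular X x r \<and> (\<forall>\<^sub>F y in nbhd X x. f y = r y * z a0 y)"
    if f: "regular X x f" "f x = 0" for f
  proof -
    obtain q where q: "\<forall>b. regular X x (q b)"
      "\<forall>\<^sub>F y in nbhd X x. f y = f x + (\<Sum>b\<in>I. q b y * (affine_coord k b y - v b))"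
      using regular_expand[OF fin X x v vk f(1)] by blast
    have "\<forall>\<^sub>F y in nbhd X x. f y = (\<Sum>b\<in>I. q b y * s b y) * z a0 y"
      using q(2) s_ev
    proof eventually_elim
      case (elim y)
      have "f y = (\<Sum>b\<in>I. q b y * z b y)" using elim(1) f(2) unfolding z_def by simp
      also have "\<dots> = (\<Sum>b\<in>I. q b y * s b y * z a0 y)"
        by (rule sum.cong[OF refl]) (metis elim(2) mult.assoc)
      finally show ?case by (simp add: sum_distrib_right)
    qed
    moreover have "regular X x (\<lambda>y. \<Sum>b\<in>I. q b y * s b y)"
      using q(1) s fin by (intro regular_sum regular_mult) auto
    ultimately show ?thesis by blast
  qed
  then show ?thesis using zr zx by blast
qed

section \<open>Lifting the section to the blow-up\<close>

text \<open>Regular coordinates come with different degrees and denominators. Multiplying by the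
  product of all denominators, finitely many since \<open>J\<close> is finite, yields forms
  \<open>H j\<close> of one degree; the common factor is nonzero and does not change the
  point.\<close>

lemma morphism_regularI:
  assumes X: "X \<subseteq> proj_space UNIV" and J: "finite J" and Y: "Y \<subseteq> proj_space J"
    and f: "\<And>x. x \<in> X \<Longrightarrow> f x \<in> Y"
    and g: "\<And>x. x \<in> X \<Longrightarrow> \<exists>g. (\<forall>j. regular X x (g j)) \<and> (\<forall>\<^sub>F y in nbhd X x. (\<lambda>j. g j y) \<in> f y)"
  shows "morphism X Y f"
proof (rule morphismI[OF X f])
  fix x assume x: "x \<in> X"
  obtain g where g: "\<forall>j. regular X x (g j)" "\<forall>\<^sub>F y in nbhd X x. (\<lambda>j. g j y) \<in> f y"
    using g[OF x] by blast
  define Q where "Q = (\<lambda>j F G. \<forall>\<^sub>F y in nbhd X x. \<forall>v\<in>y. G v \<noteq> 0 \<and> g j y = F v / G v)"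
  have "\<forall>j. \<exists>d F G. form d F \<and> form d G \<and> Q j F G"
    using g(1) unfolding regular_def Q_def .
  then obtain d F G where "\<forall>j. form (d j) (F j) \<and> form (d j) (G j) \<and> Q j (F j) (G j)"
    by metis
  then have FG: "\<And>j. form (d j) (F j)" "\<And>j. form (d j) (G j)"
    "\<And>j. \<forall>\<^sub>F y in nbhd X x. \<forall>v\<in>y. G j v \<noteq> 0 \<and> g j y = F j v / G j v"
    unfolding Q_def by blast+
  define D where "D = (\<Sum>j\<in>J. d j)"
  define H where "H = (\<lambda>j v. if j \<in> J then F j v * (\<Prod>l\<in>J - {j}. G l v) else 0)"
  have H: "form D (H j)" for j
  proof (cases "j \<in> J")
    case True
    have "form (d j + (\<Sum>l\<in>J - {j}. d l)) (\<lambda>v. F j v * (\<Prod>l\<in>J - {j}. G l v))"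
      using J FG by (intro form_mult form_prod) auto
    then show ?thesis unfolding H_def D_def using True J by (simp add: sum.remove)
  next
    case False
    then show ?thesis unfolding H_def by (simp add: form_zero)
  qed
  have "\<forall>\<^sub>F y in nbhd X x. \<forall>j\<in>J. \<forall>v\<in>y. G j v \<noteq> 0 \<and> g j y = F j v / G j v"
    using J FG(3) by (simp add: eventually_ball_finite_distrib)
  with g(2) eventually_nbhd_member[OF X x]
  have "\<forall>\<^sub>F y in nbhd X x. \<forall>v\<in>y. (\<lambda>j. H j v) \<in> f y"
  proof eventually_elim
    case (elim y)
    have fy: "f y \<in> proj_space J" using f[OF elim(2)] Y by blast
    show ?case
    proof
      fix v assume v: "v \<in> y"
      have "H j v = (\<Prod>l\<in>J. G l v) * g j y" for j
      proof (cases "j \<in> J")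
        case True
        then have "g j y * G j v = F j v" using elim(3) v by simp
        moreover have "(\<Prod>l\<in>J. G l v) = G j v * (\<Prod>l\<in>J - {j}. G l v)" using J True by (rule prod.remove)
        ultimately show ?thesis unfolding H_def using True by (simp add: mult_ac)
      next
        case False
        then show ?thesis unfolding H_def using point_outside[OF fy elim(1)] by simp
      qed
      moreover have "(\<Prod>l\<in>J. G l v) \<noteq> 0" using elim(3) v J by simp
      ultimately show "(\<lambda>j. H j v) \<in> f y" using point_scale[OF fy elim(1)] by simp
    qed
  qed
  then show "\<exists>d F. (\<forall>j. form d (F j)) \<and> (\<forall>\<^sub>F y in nbhd X x. \<forall>v\<in>y. (\<lambda>j. F j v) \<in> f y)"
    using H by blast
qed

lemma projective_varietyD:
  assumes "projective_variety X"
  shows "X \<subseteq> proj_space UNIV" "closedin zariski X" "irreducible_set X" "\<exists>I. finite I \<and> X \<subseteq> proj_space I"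
  using assms proj_space_subset_UNIV unfolding projective_variety_def by blast+

lemma closedin_zariski_fibre:
  assumes "morphism X Y f" "closedin zariski X" "Y \<subseteq> proj_space UNIV" "P \<in> Y"
  shows "closedin zariski {x\<in>X. f x = P}"
  using closedin_zariski_equalizer[OF assms(1) morphism_const[OF _ assms(4,3)] assms(2,3)]
    closedin_subset[OF assms(2)] by (simp add: topspace_zariski)

lemma eventually_neq:
  assumes f: "morphism X Y f" and X: "closedin zariski X" and Y: "Y \<subseteq> proj_space UNIV"
    and "P \<in> Y" and x: "x \<in> X" "f x \<noteq> P"
  shows "\<forall>\<^sub>F y in nbhd X x. f y \<noteq> P"
proof -
  have Xu: "X \<subseteq> proj_space UNIV" using X closedin_subset topspace_zariski by blast
  have "closedin zariski {y\<in>X. f y = P}"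
    by (rule closedin_zariski_equalizer[OF f morphism_const[OF Xu \<open>P \<in> Y\<close> Y] X Y])
  then have "openin zariski (topspace zariski - {y\<in>X. f y = P})" by (simp add: closedin_def)
  moreover have "x \<in> topspace zariski - {y\<in>X. f y = P}" using x Xu topspace_zariski by blast
  ultimately show ?thesis unfolding eventually_nbhd[OF Xu x(1)] by blast
qed

text \<open>A strict chain of two nonempty subsets does not fit into a single point, so the
  dimension would be 0.\<close>

lemma curve_not_singleton:
  assumes "smooth_projective_curve C"
  shows "\<not> C \<subseteq> {c}"
proof
  assume C: "C \<subseteq> {c}"
  have "krull_dim C \<le> 0"
    unfolding krull_dim_def
  proof (rule SUP_least, clarify)
    fix n Z
    assume Z: "\<forall>k\<le>n. closedin zariski (Z k) \<and> irreducible_set (Z k) \<and> Z k \<subseteq> C"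
      "\<forall>k<n. Z k \<subset> Z (Suc k)"
    have "n = 0"
    proof (rule ccontr)
      assume "n \<noteq> 0"
      then have "Z 0 \<subset> Z 1" "Z 1 \<subseteq> C" "Z 0 \<noteq> {}" using Z unfolding irreducible_set_def by auto
      then show False using C by blast
    qed
    then show "enat n \<le> 0" by (simp add: zero_enat_def)
  qed
  then show False using assms unfolding smooth_projective_curve_def by simp
qed

text \<open>Otherwise the point \<open>c\<close> and the complement of its neighbourhood would be
  two closed sets covering the irreducible curve.\<close>

lemma curve_not_isolated:
  assumes C: "smooth_projective_curve C" and c: "c \<in> C"
  shows "\<not> (\<forall>\<^sub>F y in nbhd C c. y = c)"
proof
  assume "\<forall>\<^sub>F y in nbhd C c. y = c"
  have pv: "projective_variety C" using C unfolding smooth_projective_curve_def by blast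
  note Cp = projective_varietyD(1)[OF pv] and Cc = projective_varietyD(2)[OF pv]
  from \<open>\<forall>\<^sub>F y in nbhd C c. y = c\<close> obtain U where U: "openin zariski U" "c \<in> U" "\<forall>y\<in>U \<inter> C. y = c"
    unfolding eventually_nbhd[OF Cp c] by blast
  have "closedin zariski {y\<in>C. y = c}" by (rule closedin_zariski_fibre[OF morphism_id[OF Cp] Cc Cp c])
  moreover have "closedin zariski (topspace zariski - U)" using U(1) by blast
  moreover have "C \<subseteq> {y\<in>C. y = c} \<union> (topspace zariski - U)" using U(3) Cp topspace_zariski by blast
  ultimately have "C \<subseteq> {y\<in>C. y = c} \<or> C \<subseteq> topspace zariski - U"
    using projective_varietyD(3)[OF pv] unfolding irreducible_set_def by blast
  then show False using curve_not_singleton[OF C] U(2) c by blast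
qed

text \<open>The matrix is the wedge of \<open>p\<close> and \<open>v\<close>. Were it zero,
  \<open>p\<close> and \<open>v\<close> would be proportional and \<open>x\<close> would equal
  \<open>P\<close>.\<close>

lemma projection_from_point:
  assumes P: "P \<in> proj_space I" and x: "x \<in> proj_space I" and p: "p \<in> P" and v: "v \<in> x" and "x \<noteq> P"
  shows "(\<lambda>(i, j). p i * v j - p j * v i) \<in> projection_from P x"
    and "projection_from P x \<in> proj_space (I \<times> I)"
proof -
  let ?u = "\<lambda>(i, j). p i * v j - p j * v i"
  show "?u \<in> projection_from P x" unfolding projection_from_def using p v by blast
  have "projection_from P x = proj_class ?u"
  proof (intro equalityI subsetI)
    fix w assume "w \<in> projection_from P x"
    then obtain p' v' where w: "p' \<in> P" "v' \<in> x" "w = (\<lambda>(i, j). p' i * v' j - p' j * v' i)"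
      unfolding projection_from_def by blast
    obtain a where a: "a \<noteq> 0" "p' = (\<lambda>i. a * p i)" using point_proportional[OF P p w(1)] .
    obtain b where b: "b \<noteq> 0" "v' = (\<lambda>i. b * v i)" using point_proportional[OF x v w(2)] .
    have "w = (\<lambda>i. (a * b) * ?u i)" unfolding w(3) a(2) b(2) by (auto simp: fun_eq_iff algebra_simps)
    moreover have "a * b \<noteq> 0" using a(1) b(1) by simp
    ultimately show "w \<in> proj_class ?u" unfolding proj_class_def by blast
  next
    fix w assume "w \<in> proj_class ?u"
    then obtain c where c: "c \<noteq> 0" "w = (\<lambda>i. c * ?u i)" unfolding proj_class_def by blast
    then have "w = (\<lambda>(i, j). p i * (c * v j) - p j * (c * v i))" by (auto simp: fun_eq_iff algebra_simps)
    then show "w \<in> projection_from P x"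
      unfolding projection_from_def using p point_scale[OF x v c(1)]
      by (intro CollectI exI[of _ p] exI[of _ "\<lambda>i. c * v i"] conjI)
  qed
  moreover have "proj_class ?u \<in> proj_space (I \<times> I)"
  proof -
    have "\<exists>i j. p i * v j - p j * v i \<noteq> 0"
    proof (rule ccontr)
      assume "\<not> ?thesis"
      then have e: "p i * v j = p j * v i" for i j by simp
      obtain i where i: "p i \<noteq> 0" using point_nonzero[OF P p] .
      obtain j where j: "v j \<noteq> 0" using point_nonzero[OF x v] .
      have "v i \<noteq> 0" using e[of i j] i j by auto
      moreover have "v = (\<lambda>j. (v i / p i) * p j)" using e[of i] i by (auto simp: fun_eq_iff field_simps)
      ultimately have "v \<in> P" using point_scale[OF P p, of "v i / p i"] i by simp
      then show False using point_eqI[OF x P v] \<open>x \<noteq> P\<close> by blast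
    qed
    then obtain i j where ij: "?u (i, j) \<noteq> 0" by auto
    then show ?thesis
    proof (rule proj_class_in_proj_space)
      show "?u k = 0" if "k \<notin> I \<times> I" for k
        using that point_outside[OF P p] point_outside[OF x v] by (cases k) auto
    qed
  qed
  ultimately show "projection_from P x \<in> proj_space (I \<times> I)" by simp
qed

lemma curve_uniformizer:
  assumes C: "smooth_projective_curve C" and c: "c \<in> C"
  shows "\<exists>t. regular C c t \<and> t c = 0 \<and> (\<forall>f. regular C c f \<and> f c = 0 \<longrightarrow>
    (\<exists>r. regular C c r \<and> (\<forall>\<^sub>F y in nbhd C c. f y = r y * t y)))"
proof -
  have pv: "projective_variety C" using C unfolding smooth_projective_curve_def by blast
  obtain I where I: "finite I" "C \<subseteq> proj_space I" using projective_varietyD(4)[OF pv] by blast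
  have cI: "c \<in> proj_space I" using c I(2) by blast
  obtain w where w: "w \<in> c" using point_nonempty[OF cI] .
  obtain k where k: "w k \<noteq> 0" using point_nonzero[OF cI w] .
  define v where "v = (\<lambda>i. inverse (w k) * w i)"
  have v: "v \<in> c" unfolding v_def using point_scale[OF cI w] k by simp
  have vk: "v k = 1" unfolding v_def using k by simp
  have "enat (cfun.dim (cone_tangent_space C v)) = krull_dim C + 1"
    using C v c unfolding smooth_projective_curve_def smooth_def by blast
  also have "\<dots> = enat 2"
    using C unfolding smooth_projective_curve_def by (simp add: one_enat_def numeral_eq_enat)
  finally have "cfun.dim (cone_tangent_space C v) = 2" by simp
  from uniformizer[OF I c v vk this] show ?thesis .
qed

text \<open>The wedge of \<open>p\<close> with \<sigma>(y) is \<open>t y\<close> times the wedge of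
  \<open>p\<close> with \<open>r y\<close>. Dropping the factor \<open>t\<close> changes no point
  with y \<noteq> c and leaves a vector that is nonzero at \<open>c\<close>; its class there is
  \<open>T\<close>.\<close>

lemma projection_lift_local:
  assumes C: "smooth_projective_curve C" and S: "S \<subseteq> proj_space I" "finite I"
    and \<pi>: "morphism S C \<pi>" and \<sigma>: "morphism C S \<sigma>" and sec: "\<And>c. c \<in> C \<Longrightarrow> \<pi> (\<sigma> c) = c"
    and c: "c \<in> C"
  shows "\<exists>T g. T \<in> proj_space (I \<times> I) \<and> (\<forall>ij. regular C c (g ij)) \<and> (\<lambda>ij. g ij c) \<in> T \<and>
    (\<forall>\<^sub>F y in nbhd C c. y \<noteq> c \<longrightarrow> (\<lambda>ij. g ij y) \<in> projection_from (\<sigma> c) (\<sigma> y))"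
proof -
  have Cp: "C \<subseteq> proj_space UNIV"
    using C projective_varietyD(1) unfolding smooth_projective_curve_def by blast
  have Sp: "S \<subseteq> proj_space UNIV" using proj_space_subset_UNIV[OF S(1)] .
  have \<sigma>_inj: "a = b" if "a \<in> C" "b \<in> C" "\<sigma> a = \<sigma> b" for a b
    using sec that by metis
  let ?P = "\<sigma> c"
  have PS: "?P \<in> S" using morphism_into[OF \<sigma> c] .
  have PI: "?P \<in> proj_space I" using PS S(1) by blast
  obtain w where w: "w \<in> ?P" using point_nonempty[OF PI] .
  obtain k where k: "w k \<noteq> 0" using point_nonzero[OF PI w] .
  define p where "p = (\<lambda>i. inverse (w k) * w i)"
  have p: "p \<in> ?P" unfolding p_def using point_scale[OF PI w] k by simp
  have pk: "p k = 1" unfolding p_def using k by simp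
  have pk0: "p k \<noteq> 0" using pk by simp
  define a where "a = (\<lambda>b y. affine_coord k b (\<sigma> y))"
  have ar: "regular C c (a b)" for b
    unfolding a_def using regular_compose[OF \<sigma> Cp Sp c regular_affine_coord[OF Sp PS p pk0]] .
  have ac: "a b c = p b" for b unfolding a_def using affine_coord_eq[OF PI p] pk by simp
  have a\<sigma>: "\<forall>\<^sub>F y in nbhd C c. (\<lambda>i. a i y) \<in> \<sigma> y \<and> a k y = 1"
    unfolding a_def using eventually_morphism[OF \<sigma> Cp Sp c eventually_affine_coord[OF Sp PS p pk0]] .
  obtain t where t: "regular C c t" "t c = 0"
    "\<forall>f. regular C c f \<and> f c = 0 \<longrightarrow> (\<exists>r. regular C c r \<and> (\<forall>\<^sub>F y in nbhd C c. f y = r y * t y))"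
    using curve_uniformizer[OF C c] by blast
  have "\<forall>b. \<exists>r. regular C c r \<and> (\<forall>\<^sub>F y in nbhd C c. a b y - p b = r y * t y)"
    
  proof
    fix b
    have "regular C c (\<lambda>y. a b y - p b)" by (intro regular_diff ar regular_const)
    then show "\<exists>r. regular C c r \<and> (\<forall>\<^sub>F y in nbhd C c. a b y - p b = r y * t y)"
      using t(3) ac by simp
  qed
  from choice[OF this] obtain r0 where
    r0: "\<forall>b. regular C c (r0 b) \<and> (\<forall>\<^sub>F y in nbhd C c. a b y - p b = r0 b y * t y)"
    by (rule exE)
  \<comment> \<open>Outside \<open>I - {k}\<close> the coordinate \<open>a b\<close> equals
    \<open>p b\<close> near \<open>c\<close>, so 0 is a valid quotient. This choice gives one
    neighbourhood for all \<open>b\<close>, keeps the lifted point inside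
    \<open>proj_space (I \<times> I)\<close> and normalizes \<open>r k\<close> to 0.\<close>
  define r where "r = (\<lambda>b. if b \<in> I - {k} then r0 b else (\<lambda>y. 0))"
  have rr: "regular C c (r b)" for b unfolding r_def using r0 by (auto intro: regular_const)
  have "\<forall>\<^sub>F y in nbhd C c. \<forall>b\<in>I. a b y - p b = r0 b y * t y"
    using r0 S(2) by (simp add: eventually_ball_finite_distrib)
  then have ap: "\<forall>\<^sub>F y in nbhd C c. \<forall>b. a b y = p b + r b y * t y"
    using a\<sigma> eventually_nbhd_member[OF Cp c]
  proof eventually_elim
    case (elim y)
    have y: "\<sigma> y \<in> proj_space I" using morphism_into[OF \<sigma> elim(3)] S(1) by blast
    have "a b y = p b + r b y * t y" for b
    proof (cases "b \<in> I - {k}")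
      case True
      then have "a b y - p b = r b y * t y" using elim(1) unfolding r_def by simp
      then show ?thesis by (simp add: algebra_simps)
    next
      case False
      then have "a b y = p b"
        using elim(2) pk point_outside[OF y, of "\<lambda>i. a i y" b] point_outside[OF PI p, of b] by auto
      then show ?thesis using False unfolding r_def by auto
    qed
    then show ?case ..
  qed
  \<comment> \<open>A zero of \<open>t\<close> near \<open>c\<close> forces
    \<open>\<sigma> y = \<sigma> c\<close>, and a section is injective.\<close>
  have t0: "\<forall>\<^sub>F y in nbhd C c. t y = 0 \<longrightarrow> y = c"
    using ap a\<sigma> eventually_nbhd_member[OF Cp c]
  proof eventually_elim
    case (elim y)
    show ?case
    proof
      assume "t y = 0"
      then have "(\<lambda>i. a i y) = p" using elim(1) by auto
      then have "p \<in> \<sigma> y" using elim(2) by metis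
      then have "\<sigma> y = ?P"
        by (rule point_eqI[OF subsetD[OF Sp morphism_into[OF \<sigma> elim(3)]] PI _ p])
      then show "y = c" by (rule \<sigma>_inj[OF elim(3) c])
    qed
  qed
  have "\<exists>b. r b c \<noteq> 0"
  proof (rule ccontr)
    assume "\<not> ?thesis"
    then have rc: "r b c = 0" for b by blast
    \<comment> \<open>\<open>t = t \<circ> \<pi> \<circ> \<sigma>\<close> is then \<open>t\<close> times a function vanishing at \<open>c\<close>, so \<open>t\<close> vanishes near \<open>c\<close>\<close>
    have "regular S ?P (\<lambda>u. t (\<pi> u))"
      by (rule regular_compose[OF \<pi> Sp Cp PS]) (simp add: sec[OF c] t(1))
    from regular_expand[OF S(2,1) PS p pk this] obtain q where q: "\<forall>b. regular S ?P (q b)"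
      "\<forall>\<^sub>F u in nbhd S ?P. t (\<pi> u) = t (\<pi> ?P) + (\<Sum>b\<in>I. q b u * (affine_coord k b u - p b))"
      by blast
    let ?s = "\<lambda>y. \<Sum>b\<in>I. q b (\<sigma> y) * r b y"
    have "\<forall>\<^sub>F y in nbhd C c. t y = ?s y * t y"
      using eventually_morphism[OF \<sigma> Cp Sp c q(2)] ap eventually_nbhd_member[OF Cp c]
    proof eventually_elim
      case (elim y)
      have "t y = (\<Sum>b\<in>I. q b (\<sigma> y) * (a b y - p b))"
        using elim(1) sec[OF elim(3)] sec[OF c] t(2) unfolding a_def by simp
      also have "\<dots> = ?s y * t y" using elim(2) by (simp add: sum_distrib_right mult.assoc)
      finally show ?case .
    qed
    moreover have "regular C c (\<lambda>y. 1 - ?s y)"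
      using q(1) rr S(2)
      by (intro regular_diff regular_const regular_sum regular_mult regular_compose[OF \<sigma> Cp Sp c]) auto
    then have "\<forall>\<^sub>F y in nbhd C c. 1 - ?s y \<noteq> 0"
      by (rule regular_nonzero[OF Cp c]) (simp add: rc)
    ultimately have "\<forall>\<^sub>F y in nbhd C c. y = c" using t0
    proof eventually_elim
      case (elim y)
      have "(1 - ?s y) * t y = t y - ?s y * t y" by (simp add: left_diff_distrib)
      then have "(1 - ?s y) * t y = 0" using elim(1) by simp
      then show ?case using elim(2,3) by simp
    qed
    then show False using curve_not_isolated[OF C c] by blast
  qed
  then obtain b where b: "r b c \<noteq> 0" by blast
  define g where "g = (\<lambda>(i, j) y. p i * r j y - p j * r i y)"
  \<comment> \<open>With \<open>p k = 1\<close> and \<open>r k = 0\<close>, the entry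
    \<open>(k, b)\<close> of the wedge at \<open>c\<close> is exactly \<open>r b c\<close>, so the
    wedge is nonzero.\<close>
  have "r k c = 0" unfolding r_def by simp
  then have gkb: "g (k, b) c \<noteq> 0" unfolding g_def using b pk by simp
  have gr: "regular C c (g ij)" for ij
    unfolding g_def by (cases ij) (auto intro!: regular_diff regular_mult regular_const rr)
  have "proj_class (\<lambda>ij. g ij c) \<in> proj_space (I \<times> I)"
  proof (rule proj_class_in_proj_space[where v = "\<lambda>ij. g ij c", OF gkb])
    show "g ij c = 0" if "ij \<notin> I \<times> I" for ij
      using that point_outside[OF PI p] unfolding g_def r_def by (cases ij) auto
  qed
  moreover have "\<forall>\<^sub>F y in nbhd C c. y \<noteq> c \<longrightarrow> (\<lambda>ij. g ij y) \<in> projection_from ?P (\<sigma> y)"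
    using ap t0 a\<sigma> eventually_nbhd_member[OF Cp c]
  proof eventually_elim
    case (elim y)
    show ?case
    proof
      assume yc: "y \<noteq> c"
      have ty: "t y \<noteq> 0" using elim(2) yc by blast
      have y: "\<sigma> y \<in> proj_space I" using morphism_into[OF \<sigma> elim(4)] S(1) by blast
      have ne: "\<sigma> y \<noteq> ?P" using \<sigma>_inj[OF elim(4) c] yc by blast
      note pr = projection_from_point[OF PI y p conjunct1[OF elim(3)] ne]
      have "g ij y = inverse (t y) * (case ij of (i, j) \<Rightarrow> p i * a j y - p j * a i y)" for ij
      proof (cases ij)
        case (Pair i j)
        have "p i * a j y - p j * a i y = t y * (p i * r j y - p j * r i y)"
          using elim(1) by (simp add: algebra_simps)
        then show ?thesis using ty Pair unfolding g_def by simp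
      qed
      then show "(\<lambda>ij. g ij y) \<in> projection_from ?P (\<sigma> y)"
        using point_scale[OF pr(2,1), of "inverse (t y)"] ty by simp
    qed
  qed
  ultimately show ?thesis using gr proj_class_self by blast
qed

text \<open>The value of \<open>\<tau>\<close> is chosen point by point. The choices fit together
  because only the centre of each small neighbourhood can lie over \<open>P\<close>; at every other
  point the value is forced to be the projection from \<open>P\<close>.\<close>

lemma projection_lift:
  assumes C: "smooth_projective_curve C" and S: "S \<subseteq> proj_space I" "finite I"
    and \<pi>: "morphism S C \<pi>" and \<sigma>: "morphism C S \<sigma>" and sec: "\<And>c. c \<in> C \<Longrightarrow> \<pi> (\<sigma> c) = c"
    and P: "P \<in> S"
  obtains \<tau> where "morphism C (proj_space UNIV) \<tau>"
    "\<And>c. c \<in> C \<Longrightarrow> \<sigma> c \<noteq> P \<Longrightarrow> \<tau> c = projection_from P (\<sigma> c)"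
proof -
  have pv: "projective_variety C" using C unfolding smooth_projective_curve_def by blast
  note Cp = projective_varietyD(1)[OF pv] and Cc = projective_varietyD(2)[OF pv]
  have Sp: "S \<subseteq> proj_space UNIV" using proj_space_subset_UNIV[OF S(1)] .
  have \<sigma>_inj: "a = b" if "a \<in> C" "b \<in> C" "\<sigma> a = \<sigma> b" for a b
    using sec that by metis
  have PI: "P \<in> proj_space I" using P S(1) by blast
  \<comment> \<open>The representation \<open>g\<close> is required on a punctured neighbourhood
    and, separately, at the centre. Thus admissibility of \<open>T\<close> at \<open>c\<close> does
    not refer to the values chosen at other points.\<close>
  define good where "good = (\<lambda>c T. T \<in> proj_space (I \<times> I) \<and> (\<sigma> c \<noteq> P \<longrightarrow> T = projection_from P (\<sigma> c)) \<and>
    (\<exists>g. (\<forall>ij. regular C c (g ij)) \<and> (\<lambda>ij. g ij c) \<in> T \<and>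
      (\<forall>\<^sub>F y in nbhd C c. y \<noteq> c \<longrightarrow> \<sigma> y \<noteq> P \<and> (\<lambda>ij. g ij y) \<in> projection_from P (\<sigma> y))))"
  have "\<exists>T. good c T" if c: "c \<in> C" for c
  proof (cases "\<sigma> c = P")
    case True
    obtain T g where Tg: "T \<in> proj_space (I \<times> I)" "\<forall>ij. regular C c (g ij)" "(\<lambda>ij. g ij c) \<in> T"
      "\<forall>\<^sub>F y in nbhd C c. y \<noteq> c \<longrightarrow> (\<lambda>ij. g ij y) \<in> projection_from (\<sigma> c) (\<sigma> y)"
      using projection_lift_local[OF C S \<pi> \<sigma> sec c] by blast
    have "\<forall>\<^sub>F y in nbhd C c. y \<noteq> c \<longrightarrow> \<sigma> y \<noteq> P \<and> (\<lambda>ij. g ij y) \<in> projection_from P (\<sigma> y)"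
      using Tg(4) eventually_nbhd_member[OF Cp c]
    proof eventually_elim
      case (elim y)
      then show ?case using \<sigma>_inj[OF elim(2) c] True by auto
    qed
    then have "good c T" unfolding good_def using Tg True by blast
    then show ?thesis ..
  next
    case False
    have \<sigma>S: "\<sigma> c \<in> S" using morphism_into[OF \<sigma> c] .
    have \<sigma>I: "\<sigma> c \<in> proj_space I" using \<sigma>S S(1) by blast
    obtain p where p: "p \<in> P" using point_nonempty[OF PI] .
    obtain w where w: "w \<in> \<sigma> c" using point_nonempty[OF \<sigma>I] .
    obtain k where k: "w k \<noteq> 0" using point_nonzero[OF \<sigma>I w] .
    define a where "a = (\<lambda>b y. affine_coord k b (\<sigma> y))"
    have ar: "regular C c (a b)" for b
      unfolding a_def using regular_compose[OF \<sigma> Cp Sp c regular_affine_coord[OF Sp \<sigma>S w k]] .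
    have a\<sigma>: "\<forall>\<^sub>F y in nbhd C c. (\<lambda>i. a i y) \<in> \<sigma> y"
      using eventually_morphism[OF \<sigma> Cp Sp c eventually_affine_coord[OF Sp \<sigma>S w k]]
      unfolding a_def by eventually_elim blast
    define g where "g = (\<lambda>(i, j) y. p i * a j y - p j * a i y)"
    have g_eq: "(\<lambda>ij. g ij y) = (\<lambda>(i, j). p i * a j y - p j * a i y)" for y
      unfolding g_def by auto
    have gr: "\<forall>ij. regular C c (g ij)"
      unfolding g_def by (auto intro!: regular_diff regular_mult regular_const ar)
    have ev: "\<forall>\<^sub>F y in nbhd C c. \<sigma> y \<noteq> P \<and> (\<lambda>ij. g ij y) \<in> projection_from P (\<sigma> y)"
      using a\<sigma> eventually_neq[OF \<sigma> Cc Sp P c False] eventually_nbhd_member[OF Cp c]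
    proof eventually_elim
      case (elim y)
      have y: "\<sigma> y \<in> proj_space I" using morphism_into[OF \<sigma> elim(3)] S(1) by blast
      show ?case unfolding g_eq using projection_from_point(1)[OF PI y p elim(1,2)] elim(2) by blast
    qed
    have "projection_from P (\<sigma> c) \<in> proj_space (I \<times> I)"
      using projection_from_point(2)[OF PI \<sigma>I p w False] .
    moreover have "(\<lambda>ij. g ij c) \<in> projection_from P (\<sigma> c)"
      using eventually_nbhd_self[OF ev Cp c] by blast
    moreover have "\<forall>\<^sub>F y in nbhd C c. y \<noteq> c \<longrightarrow> \<sigma> y \<noteq> P \<and> (\<lambda>ij. g ij y) \<in> projection_from P (\<sigma> y)"
      using ev by eventually_elim blast
    ultimately have "good c (projection_from P (\<sigma> c))" unfolding good_def using gr by blast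
    then show ?thesis ..
  qed
  then obtain \<tau> where \<tau>: "\<And>c. c \<in> C \<Longrightarrow> good c (\<tau> c)" by metis
  have \<tau>P: "\<tau> c = projection_from P (\<sigma> c)" if "c \<in> C" "\<sigma> c \<noteq> P" for c
    using \<tau>[OF that(1)] that(2) unfolding good_def by blast
  have \<tau>I: "\<tau> c \<in> proj_space (I \<times> I)" if "c \<in> C" for c
    using \<tau>[OF that] unfolding good_def by blast
  have "morphism C (proj_space (I \<times> I)) \<tau>"
  proof (rule morphism_regularI[OF Cp _ subset_refl \<tau>I])
    show "finite (I \<times> I)" using S(2) by blast
    fix c assume c: "c \<in> C"
    obtain g where g: "\<forall>ij. regular C c (g ij)" "(\<lambda>ij. g ij c) \<in> \<tau> c"
      "\<forall>\<^sub>F y in nbhd C c. y \<noteq> c \<longrightarrow> \<sigma> y \<noteq> P \<and> (\<lambda>ij. g ij y) \<in> projection_from P (\<sigma> y)"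
      using \<tau>[OF c] unfolding good_def by blast
    have "\<forall>\<^sub>F y in nbhd C c. (\<lambda>ij. g ij y) \<in> \<tau> y"
      using g(3) eventually_nbhd_member[OF Cp c]
    proof eventually_elim
      case (elim y)
      \<comment> \<open>At the centre \<open>g\<close> represents the chosen value; elsewhere
        \<sigma>(y) \<noteq> P, and \<open>\<tau>P\<close> identifies the value.\<close>
      show ?case using elim \<tau>P g(2) by (cases "y = c") auto
    qed
    then show "\<exists>g. (\<forall>j. regular C c (g j)) \<and> (\<forall>\<^sub>F y in nbhd C c. (\<lambda>j. g j y) \<in> \<tau> y)"
      using g(1) by blast
  qed
  then have "morphism C (proj_space UNIV) \<tau>"
    by (rule morphism_codomain) (use \<tau>I proj_space_mono[OF subset_UNIV] in blast)
  then show thesis using that \<tau>P by blast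
qed

section \<open>The blow-up of a point\<close>

lemma segre_projection_from_in_proj_space:
  assumes "P \<in> proj_space UNIV" "x \<in> proj_space UNIV" "x \<noteq> P"
  shows "projection_from P x \<in> proj_space UNIV" "segre (x, projection_from P x) \<in> proj_space UNIV"
proof -
  obtain p where p: "p \<in> P" using point_nonempty[OF assms(1)] .
  obtain v where v: "v \<in> x" using point_nonempty[OF assms(2)] .
  show *: "projection_from P x \<in> proj_space UNIV"
    using projection_from_point(2)[OF assms(1,2) p v assms(3)] by simp
  show "segre (x, projection_from P x) \<in> proj_space UNIV"
    using segre_in_proj_space[OF assms(2) *] by simp
qed

lemma graph_subset_standard_blowup:
  assumes "X \<subseteq> proj_space UNIV" "P \<in> proj_space UNIV" "x \<in> X" "x \<noteq> P"
  shows "segre (x, projection_from P x) \<in> standard_blowup X P"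
proof -
  have "(\<lambda>x. segre (x, projection_from P x)) ` (X - {P}) \<subseteq> topspace zariski"
    unfolding topspace_zariski using assms(1) segre_projection_from_in_proj_space[OF assms(2)] by blast
  from closure_of_subset[OF this] show ?thesis
    unfolding standard_blowup_def using assms(3,4) by blast
qed

text \<open>Guarantees that the points added by the closure are still pairs with first component in
  \<open>X\<close>, so that the blow-down is a morphism into \<open>X\<close>.\<close>

lemma standard_blowup_subset:
  assumes "closedin zariski X" "P \<in> proj_space UNIV"
  shows "standard_blowup X P \<subseteq> segre ` (X \<times> proj_space UNIV)"
  unfolding standard_blowup_def
proof (rule closure_of_minimal)
  have "X \<subseteq> proj_space UNIV" using closedin_subset[OF assms(1)] by (simp add: topspace_zariski)
  then show "(\<lambda>x. segre (x, projection_from P x)) ` (X - {P}) \<subseteq> segre ` (X \<times> proj_space UNIV)"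
    using segre_projection_from_in_proj_space(1)[OF assms(2)] by blast
  show "closedin zariski (segre ` (X \<times> (proj_space UNIV :: ('a \<times> 'a) point set)))"
    by (rule closedin_zariski_segre_product[OF assms(1)])
qed

text \<open>The closure adds nothing over \<open>x \<noteq> P\<close>: equations valid on the graph
  persist on its closure, and there they still determine \<open>y\<close>, because the wedge of
  \<open>p\<close> and \<open>x\<close> is nonzero.\<close>

lemma standard_blowup_fibre:
  assumes X: "X \<subseteq> proj_space UNIV" and P: "P \<in> proj_space UNIV"
    and x: "x \<in> proj_space UNIV" and y: "y \<in> proj_space UNIV" and xP: "x \<noteq> P"
    and z: "segre (x, y) \<in> standard_blowup X P"
  shows "y = projection_from P x"
proof -
  obtain p where p: "p \<in> P" using point_nonempty[OF P] .
  obtain v where v: "v \<in> x" using point_nonempty[OF x] .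
  obtain w where w: "w \<in> y" using point_nonempty[OF y] .
  \<comment> \<open>
    With \<open>q = p \<wedge> x\<close>, proportionality of \<open>y\<close> and \<open>q\<close> reads \<open>y (j, k) * q (l, m) = y (l, m) * q (j, k)\<close>,
    which is linear in the Segre coordinates \<open>x i * y (j, k)\<close>.
  \<close>
  define T :: "(('a \<times> 'a \<times> 'a \<Rightarrow> complex) \<Rightarrow> complex) set" where
    "T = {(\<lambda>z. (p l * z (m, (j, k)) - p m * z (l, (j, k))) - (p j * z (k, (l, m)) - p k * z (j, (l, m)))) |j k l m. True}"
  have T: "\<exists>d. form d F" if F: "F \<in> T" for F
  proof -
    obtain j k l m where "F = (\<lambda>z. (p l * z (m, (j, k)) - p m * z (l, (j, k)))
        - (p j * z (k, (l, m)) - p k * z (j, (l, m))))"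
      using F unfolding T_def by blast
    moreover have "form 1 (\<lambda>z. (p l * z (m, (j, k)) - p m * z (l, (j, k)))
        - (p j * z (k, (l, m)) - p k * z (j, (l, m))))"
      by (intro form_diff form_cmult form_coord)
    ultimately show ?thesis by blast
  qed
  have "standard_blowup X P \<subseteq> zero_locus T"
    unfolding standard_blowup_def
  proof (rule closure_of_minimal[OF _ closedin_zariski_zero_locus[OF T]], rule subsetI)
    fix s assume "s \<in> (\<lambda>x. segre (x, projection_from P x)) ` (X - {P})"
    then obtain x' where x': "x' \<in> X" "x' \<noteq> P" "s = segre (x', projection_from P x')" by blast
    have x'p: "x' \<in> proj_space UNIV" using x'(1) X by blast
    have "F u = 0" if F: "F \<in> T" and u: "u \<in> s" for F u
    proof -
      obtain v' w' where vw: "v' \<in> x'" "w' \<in> projection_from P x'" "u = (\<lambda>(i, j). v' i * w' j)"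
        using u[unfolded x'(3)] by (rule segre_memberE)
      note pr = projection_from_point[OF P x'p p vw(1) x'(2)]
      obtain c where c: "w' = (\<lambda>ij. c * (case ij of (i, j) \<Rightarrow> p i * v' j - p j * v' i))"
        using point_proportional[OF pr(2,1) vw(2)] .
      show ?thesis using F unfolding T_def vw(3) c by (auto simp: algebra_simps)
    qed
    then show "s \<in> zero_locus T"
      unfolding zero_locus_def x'(3) using segre_projection_from_in_proj_space(2)[OF P x'p x'(2)] x'(3) by blast
  qed
  then have "segre (x, y) \<in> zero_locus T" using z by blast
  then have Tz: "F (\<lambda>(i, j). v i * w j) = 0" if "F \<in> T" for F
    using that segre_member[OF v w] unfolding zero_locus_def by blast
  define q where "q = (\<lambda>(i, j). p i * v j - p j * v i)"
  have e: "q (l, m) * w (j, k) = q (j, k) * w (l, m)" for j k l m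
  proof -
    have "(\<lambda>z. (p l * z (m, (j, k)) - p m * z (l, (j, k))) - (p j * z (k, (l, m)) - p k * z (j, (l, m)))) \<in> T"
      unfolding T_def by blast
    from Tz[OF this] show ?thesis unfolding q_def by (simp add: algebra_simps)
  qed
  note pr = projection_from_point[OF P x p v xP]
  have q: "q \<in> projection_from P x" "projection_from P x \<in> proj_space UNIV"
    using pr unfolding q_def by auto
  obtain l m where lm: "q (l, m) \<noteq> 0" using point_nonzero[OF q(2,1)] by (metis surj_pair)
  obtain j k where jk: "w (j, k) \<noteq> 0" using point_nonzero[OF y w] by (metis surj_pair)
  have wlm: "w (l, m) \<noteq> 0" using e[of l m j k] lm jk by auto
  have "w = (\<lambda>ij. (w (l, m) / q (l, m)) * q ij)"
  proof
    fix ij :: "'a \<times> 'a"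
    obtain i j where "ij = (i, j)" by (cases ij)
    then show "w ij = (w (l, m) / q (l, m)) * q ij" using e[of l m i j] lm by (simp add: field_simps)
  qed
  then have "w \<in> projection_from P x"
    using point_scale[OF q(2,1), of "w (l, m) / q (l, m)"] lm wlm by simp
  then show ?thesis using point_eqI[OF y q(2) w] by blast
qed

section \<open>Semigroup laws on the blow-up\<close>

text \<open>The last part serves the uniqueness proof: with a suitable argument frozen, the product
  still reaches every point of \<open>C\<close>, in particular one whose image under the section is
  not \<open>P\<close>.\<close>

lemma curve_lawD:
  assumes law: "curve_law C m" and C: "C \<subseteq> proj_space UNIV"
  shows "morphism_prod C C C m"
    and "\<And>x y. x \<in> C \<Longrightarrow> y \<in> C \<Longrightarrow> m (x, y) \<in> C"
    and "\<And>x y z. x \<in> C \<Longrightarrow> y \<in> C \<Longrightarrow> z \<in> C \<Longrightarrow> m (m (x, y), z) = m (x, m (y, z))"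
    and "(\<forall>x\<in>C. \<forall>z\<in>C. \<exists>y\<in>C. m (x, y) = z) \<or> (\<forall>y\<in>C. \<forall>z\<in>C. \<exists>x\<in>C. m (x, y) = z)"
proof -
  have inv: "segre_inv (segre (x, y)) = (x, y)" if "x \<in> C" "y \<in> C" for x y
    using segre_inv_segre[OF subsetD[OF C that(1)] subsetD[OF C that(2)]] .
  consider (group) "elliptic_curve_group_law C m" | (left) "\<forall>x\<in>C. \<forall>y\<in>C. m (x, y) = x"
    | (right) "\<forall>x\<in>C. \<forall>y\<in>C. m (x, y) = y"
    using law unfolding curve_law_def by blast
  then have "morphism_prod C C C m \<and> (\<forall>x\<in>C. \<forall>y\<in>C. m (x, y) \<in> C) \<and>
    (\<forall>x\<in>C. \<forall>y\<in>C. \<forall>z\<in>C. m (m (x, y), z) = m (x, m (y, z))) \<and>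
    ((\<forall>x\<in>C. \<forall>z\<in>C. \<exists>y\<in>C. m (x, y) = z) \<or> (\<forall>y\<in>C. \<forall>z\<in>C. \<exists>x\<in>C. m (x, y) = z))" (is ?T)
  proof cases
    case group
    then obtain e where e: "comm_group \<lparr>carrier = C, monoid.mult = (\<lambda>x y. m (x, y)), one = e\<rparr>"
      and mor: "morphism_prod C C C m"
      unfolding elliptic_curve_group_law_def Let_def by blast
    define G where "G = \<lparr>carrier = C, monoid.mult = (\<lambda>x y. m (x, y)), one = e\<rparr>"
    interpret G: comm_group G unfolding G_def by (rule e)
    have G: "carrier G = C" "x \<otimes>\<^bsub>G\<^esub> y = m (x, y)" for x y unfolding G_def by simp_all
    have "\<exists>y\<in>C. m (x, y) = z" if "x \<in> C" "z \<in> C" for x z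
    proof (rule bexI)
      have xz: "x \<in> carrier G" "z \<in> carrier G" using that G(1) by auto
      have "inv\<^bsub>G\<^esub> x \<otimes>\<^bsub>G\<^esub> z \<in> carrier G" using xz by simp
      then show "inv\<^bsub>G\<^esub> x \<otimes>\<^bsub>G\<^esub> z \<in> C" unfolding G(1) .
      show "m (x, inv\<^bsub>G\<^esub> x \<otimes>\<^bsub>G\<^esub> z) = z"
        unfolding G(2)[symmetric] using xz by (simp add: G.m_assoc[symmetric])
    qed
    then show ?thesis using mor G.m_closed G.m_assoc unfolding G by blast
  next
    case left
    have "morphism_prod C C C m" unfolding morphism_prod_def
      by (rule morphism_cong[OF morphism_segre_inv(1)[OF C C subset_refl]])
        (use left in \<open>auto simp: inv\<close>)
    then show ?thesis using left by simp
  next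
    case right
    have "morphism_prod C C C m" unfolding morphism_prod_def
      by (rule morphism_cong[OF morphism_segre_inv(2)[OF C C subset_refl]])
        (use right in \<open>auto simp: inv\<close>)
    then show ?thesis using right by simp
  qed
  then have T: ?T .
  show "morphism_prod C C C m" by (rule T[THEN conjunct1])
  show "m (x, y) \<in> C" if "x \<in> C" "y \<in> C" for x y
    by (rule T[THEN conjunct2, THEN conjunct1, rule_format, OF that])
  show "m (m (x, y), z) = m (x, m (y, z))" if "x \<in> C" "y \<in> C" "z \<in> C" for x y z
    by (rule T[THEN conjunct2, THEN conjunct2, THEN conjunct1, rule_format, OF that])
  show "(\<forall>x\<in>C. \<forall>z\<in>C. \<exists>y\<in>C. m (x, y) = z) \<or> (\<forall>y\<in>C. \<forall>z\<in>C. \<exists>x\<in>C. m (x, y) = z)"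
    by (rule T[THEN conjunct2, THEN conjunct2, THEN conjunct2])
qed

lemma morphism_prod_pair:
  assumes f: "morphism_prod X Y Z f" and g: "morphism W X g" and h: "morphism W Y h"
    and W: "W \<subseteq> proj_space UNIV" and X: "X \<subseteq> proj_space UNIV" and Y: "Y \<subseteq> proj_space UNIV"
  shows "morphism W Z (\<lambda>w. f (g w, h w))"
proof (rule morphism_cong)
  show "morphism W Z (\<lambda>w. f (segre_inv (segre (g w, h w))))"
    by (rule morphism_compose[OF morphism_segre[OF g h W] f[unfolded morphism_prod_def] W
          segre_image_subset[OF X Y]])
  show "f (segre_inv (segre (g w, h w))) = f (g w, h w)" if "w \<in> W" for w
    using segre_inv_segre[OF subsetD[OF X morphism_into[OF g that]] subsetD[OF Y morphism_into[OF h that]]]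
    by simp
qed

text \<open>The equalizer of \<open>f\<close> and \<open>g\<close> and the locus mapped to
  \<open>P\<close> are closed and cover the irreducible \<open>X\<close>; the point \<open>y\<close>
  excludes the second.\<close>

lemma morphism_eqI:
  assumes X: "projective_variety X" and f: "morphism X X f" and g: "morphism X X g"
    and \<phi>: "morphism X S \<phi>" and S: "S \<subseteq> proj_space UNIV" and P: "P \<in> S"
    and inj: "\<And>a b. a \<in> X \<Longrightarrow> b \<in> X \<Longrightarrow> \<phi> a = \<phi> b \<Longrightarrow> \<phi> a \<noteq> P \<Longrightarrow> a = b"
    and fg: "\<And>x. x \<in> X \<Longrightarrow> \<phi> (f x) = \<phi> (g x)"
    and y: "y \<in> X" "\<phi> (f y) \<noteq> P" and x: "x \<in> X"
  shows "f x = g x"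
proof -
  note Xp = projective_varietyD(1)[OF X] and Xc = projective_varietyD(2)[OF X]
  have "closedin zariski {x\<in>X. f x = g x}" by (rule closedin_zariski_equalizer[OF f g Xc Xp])
  moreover have "closedin zariski {x\<in>X. \<phi> (f x) = P}"
    by (rule closedin_zariski_fibre[OF morphism_compose[OF f \<phi> Xp Xp] Xc S P])
  moreover have "X \<subseteq> {x\<in>X. f x = g x} \<union> {x\<in>X. \<phi> (f x) = P}"
    using inj fg morphism_into[OF f] morphism_into[OF g] by blast
  ultimately have "X \<subseteq> {x\<in>X. f x = g x} \<or> X \<subseteq> {x\<in>X. \<phi> (f x) = P}"
    using projective_varietyD(3)[OF X] unfolding irreducible_set_def by blast
  then show ?thesis using x y by blast
qed

theorem proposition1p4:
  fixes S S' :: "nat point set" and C :: "nat point set"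
    and \<mu> :: "nat point \<times> nat point \<Rightarrow> nat point"
    and \<pi> \<sigma> :: "nat point \<Rightarrow> nat point"
    and m :: "nat point \<times> nat point \<Rightarrow> nat point"
    and \<phi> :: "nat point \<Rightarrow> nat point" and P :: "nat point"
  assumes "smooth_projective_surface S"
    and "algebraic_semigroup_law S \<mu>"
    and "nontrivial_law_via S \<mu> C \<pi> \<sigma> m"
    and "P \<in> S"
    and "is_blowup S P S' \<phi>"
  shows "\<exists>!\<mu>'. \<mu>' \<in> extensional (S' \<times> S') \<and> nontrivial_semigroup_law S' \<mu>' \<and>
    (\<forall>a\<in>S'. \<forall>b\<in>S'. \<phi> (\<mu>' (a, b)) = \<mu> (\<phi> a, \<phi> b))"
proof -
  have S: "projective_variety S" using assms(1) unfolding smooth_projective_surface_def by blast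
  note Sp = projective_varietyD(1)[OF S] and Sc = projective_varietyD(2)[OF S]
  obtain I where I: "S \<subseteq> proj_space I" "finite I" using projective_varietyD(4)[OF S] by blast
  note P = \<open>P \<in> S\<close>
  have Pp: "P \<in> proj_space UNIV" using P Sp by blast
  have C: "smooth_projective_curve C" and \<pi>: "morphism S C \<pi>" and \<sigma>: "morphism C S \<sigma>"
    and sec: "\<And>c. c \<in> C \<Longrightarrow> \<pi> (\<sigma> c) = c" and law: "curve_law C m"
    and \<mu>: "\<And>a b. a \<in> S \<Longrightarrow> b \<in> S \<Longrightarrow> \<mu> (a, b) = \<sigma> (m (\<pi> a, \<pi> b))"
    using assms(3) unfolding nontrivial_law_via_def by blast+
  have Cv: "projective_variety C" using C unfolding smooth_projective_curve_def by blast
  note Cp = projective_varietyD(1)[OF Cv] and Cc = projective_varietyD(2)[OF Cv]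
  note m = curve_lawD[OF law Cp]

  \<comment> \<open>The blow-down and its injectivity away from the exceptional fibre\<close>
  let ?B = "standard_blowup S P" and ?E = "segre ` (S \<times> (proj_space UNIV :: (nat \<times> nat) point set))"
  have S': "projective_variety S'" using assms(5) unfolding is_blowup_def by blast
  note S'p = projective_varietyD(1)[OF S']
  obtain \<theta> where \<theta>: "isomorphism S' ?B \<theta>" and \<phi>\<theta>: "\<And>z. z \<in> S' \<Longrightarrow> \<phi> z = fst (segre_inv (\<theta> z))"
    using assms(5) unfolding is_blowup_def by blast
  have bij: "bij_betw \<theta> S' ?B" and \<theta>m: "morphism S' ?B \<theta>" and \<psi>m: "morphism ?B S' (inv_into S' \<theta>)"
    using \<theta> unfolding isomorphism_def by blast+
  have BE: "?B \<subseteq> ?E" by (rule standard_blowup_subset[OF Sc Pp])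
  have Ep: "?E \<subseteq> proj_space UNIV" by (rule segre_image_subset[OF Sp subset_refl])
  have Bp: "?B \<subseteq> proj_space UNIV" using BE Ep by blast
  have \<phi>: "morphism S' S \<phi>"
    by (rule morphism_cong[OF morphism_compose[OF \<theta>m morphism_segre_inv(1)[OF Sp subset_refl BE] S'p Bp]])
      (simp add: \<phi>\<theta>)
  have \<theta>_form: "\<exists>y\<in>proj_space UNIV. \<theta> z = segre (\<phi> z, y)" if z: "z \<in> S'" for z
  proof -
    obtain x y where xy: "x \<in> S" "y \<in> proj_space UNIV" "\<theta> z = segre (x, y)"
      using morphism_into[OF \<theta>m z] BE by blast
    have "\<phi> z = x" using \<phi>\<theta>[OF z] segre_inv_segre[OF subsetD[OF Sp xy(1)] xy(2)] xy(3) by simp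
    then show ?thesis using xy by blast
  qed
  \<comment> \<open>Away from \<open>P\<close> the second Segre component is a function of the
    first, so \<open>\<theta> z\<close> is determined by \<open>\<phi> z\<close>.\<close>
  have \<phi>_inj: "a = b" if ab: "a \<in> S'" "b \<in> S'" "\<phi> a = \<phi> b" "\<phi> a \<noteq> P" for a b
  proof -
    have *: "\<theta> z = segre (\<phi> z, projection_from P (\<phi> z))" if z: "z \<in> S'" "\<phi> z \<noteq> P" for z
    proof -
      obtain y where y: "y \<in> proj_space UNIV" "\<theta> z = segre (\<phi> z, y)" using \<theta>_form[OF z(1)] by blast
      have "y = projection_from P (\<phi> z)"
        by (rule standard_blowup_fibre[OF Sp Pp subsetD[OF Sp morphism_into[OF \<phi> z(1)]] y(1) z(2)])
          (use morphism_into[OF \<theta>m z(1)] y(2) in simp)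
      then show ?thesis using y(2) by simp
    qed
    have "\<theta> a = \<theta> b" using *[OF ab(1,4)] *[OF ab(2)] ab(3,4) by simp
    then show ?thesis using bij ab(1,2) unfolding bij_betw_def inj_on_def by blast
  qed

  \<comment> \<open>The strict transform of the section\<close>
  obtain \<tau> where \<tau>: "morphism C (proj_space UNIV) \<tau>"
    "\<And>c. c \<in> C \<Longrightarrow> \<sigma> c \<noteq> P \<Longrightarrow> \<tau> c = projection_from P (\<sigma> c)"
    using projection_lift[OF C I \<pi> \<sigma> sec P] by blast
  let ?\<rho> = "\<lambda>c. segre (\<sigma> c, \<tau> c)"
  have \<rho>E: "morphism C ?E ?\<rho>" by (rule morphism_segre[OF \<sigma> \<tau>(1) Cp])
  \<comment> \<open>If \<open>\<sigma>\<close> were constant with value \<open>P\<close>, applying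
    \<open>\<pi>\<close> would collapse \<open>C\<close> to one point.\<close>
  have avoid: "\<exists>c\<in>C. \<sigma> c \<noteq> P"
  proof (rule ccontr)
    assume "\<not> ?thesis"
    then have "C \<subseteq> {\<pi> P}" using sec by force
    then show False using curve_not_singleton[OF C] by blast
  qed
  \<comment> \<open>The lift lies on the graph wherever \<open>\<sigma> c \<noteq> P\<close>. The
    remaining points form a proper closed subset of the irreducible curve, and the blow-up is
    closed.\<close>
  have \<rho>B: "?\<rho> c \<in> ?B" if "c \<in> C" for c
  proof -
    have "closedin zariski ?B" unfolding standard_blowup_def by (rule closedin_closure_of)
    then have "closedin zariski {c\<in>C. ?\<rho> c \<in> ?B}" by (rule closedin_zariski_preimage[OF \<rho>E Cc Ep])
    moreover have "closedin zariski {c\<in>C. \<sigma> c = P}" by (rule closedin_zariski_fibre[OF \<sigma> Cc Sp P])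
    moreover have "?\<rho> c \<in> ?B" if "c \<in> C" "\<sigma> c \<noteq> P" for c
      unfolding \<tau>(2)[OF that] using graph_subset_standard_blowup[OF Sp Pp morphism_into[OF \<sigma> that(1)] that(2)] .
    then have "C \<subseteq> {c\<in>C. ?\<rho> c \<in> ?B} \<union> {c\<in>C. \<sigma> c = P}" by blast
    ultimately have "C \<subseteq> {c\<in>C. ?\<rho> c \<in> ?B} \<or> C \<subseteq> {c\<in>C. \<sigma> c = P}"
      using projective_varietyD(3)[OF Cv] unfolding irreducible_set_def by blast
    then show ?thesis using that avoid by blast
  qed
  define \<sigma>' where "\<sigma>' = (\<lambda>c. inv_into S' \<theta> (?\<rho> c))"
  have \<sigma>': "morphism C S' \<sigma>'"
    unfolding \<sigma>'_def by (rule morphism_compose[OF morphism_codomain[OF \<rho>E \<rho>B] \<psi>m Cp Bp])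
  have \<phi>\<sigma>': "\<phi> (\<sigma>' c) = \<sigma> c" if c: "c \<in> C" for c
  proof -
    have "\<theta> (\<sigma>' c) = ?\<rho> c" unfolding \<sigma>'_def using bij_betw_inv_into_right[OF bij \<rho>B[OF c]] .
    then show ?thesis
      using \<phi>\<theta>[OF morphism_into[OF \<sigma>' c]]
        segre_inv_segre[OF subsetD[OF Sp morphism_into[OF \<sigma> c]] morphism_into[OF \<tau>(1) c]] by simp
  qed
  define \<pi>' where "\<pi>' = (\<lambda>z. \<pi> (\<phi> z))"
  have \<pi>': "morphism S' C \<pi>'" unfolding \<pi>'_def by (rule morphism_compose[OF \<phi> \<pi> S'p Sp])
  have sec': "\<pi>' (\<sigma>' c) = c" if "c \<in> C" for c unfolding \<pi>'_def using \<phi>\<sigma>' sec that by simp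
  note \<pi>'C = morphism_into[OF \<pi>'] and \<sigma>'S = morphism_into[OF \<sigma>']

  \<comment> \<open>Existence of the law\<close>
  define \<nu> where "\<nu> = restrict (\<lambda>(a, b). \<sigma>' (m (\<pi>' a, \<pi>' b))) (S' \<times> S')"
  have \<nu>: "\<nu> (a, b) = \<sigma>' (m (\<pi>' a, \<pi>' b))" if "a \<in> S'" "b \<in> S'" for a b
    unfolding \<nu>_def using that by simp
  have \<nu>_hom: "\<phi> (\<nu> (a, b)) = \<mu> (\<phi> a, \<phi> b)" if "a \<in> S'" "b \<in> S'" for a b
    using \<nu>[OF that] \<mu>[OF morphism_into[OF \<phi>] morphism_into[OF \<phi>], OF that] \<phi>\<sigma>' m(2) \<pi>'C that
    unfolding \<pi>'_def by simp
  have "morphism_prod S' S' S' \<nu>"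
    unfolding morphism_prod_def
  proof (rule morphism_cong)
    let ?D = "segre ` (S' \<times> S')"
    have D: "?D \<subseteq> proj_space UNIV" by (rule segre_image_subset[OF S'p S'p])
    note proj = morphism_segre_inv[OF S'p S'p subset_refl]
    show "morphism ?D S' (\<lambda>z. \<sigma>' (m (\<pi>' (fst (segre_inv z)), \<pi>' (snd (segre_inv z)))))"
      by (rule morphism_compose[OF morphism_prod_pair[OF m(1) morphism_compose[OF proj(1) \<pi>' D S'p]
              morphism_compose[OF proj(2) \<pi>' D S'p] D Cp Cp] \<sigma>' D Cp])
    fix z assume "z \<in> ?D"
    then obtain a b where ab: "a \<in> S'" "b \<in> S'" "z = segre (a, b)" by blast
    have "segre_inv z = (a, b)"
      unfolding ab(3) by (rule segre_inv_segre[OF subsetD[OF S'p ab(1)] subsetD[OF S'p ab(2)]])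
    then show "\<sigma>' (m (\<pi>' (fst (segre_inv z)), \<pi>' (snd (segre_inv z)))) = \<nu> (segre_inv z)"
      using \<nu>[OF ab(1,2)] by simp
  qed
  \<comment> \<open>As \<open>\<pi>'\<close> undoes \<open>\<sigma>'\<close>, both sides reduce to
    associativity of \<open>m\<close>.\<close>
  moreover have "\<nu> (\<nu> (a, b), c) = \<nu> (a, \<nu> (b, c))" if "a \<in> S'" "b \<in> S'" "c \<in> S'" for a b c
    using that \<nu> m(2,3) \<pi>'C \<sigma>'S sec' by simp
  ultimately have "algebraic_semigroup_law S' \<nu>" unfolding algebraic_semigroup_law_def by blast
  moreover have "nontrivial_law_via S' \<nu> C \<pi>' \<sigma>' m"
    unfolding nontrivial_law_via_def using C \<pi>' \<sigma>' sec' law \<nu> by blast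
  ultimately have \<nu>_law: "nontrivial_semigroup_law S' \<nu>" unfolding nontrivial_semigroup_law_def by blast

  \<comment> \<open>Uniqueness of the law\<close>
  have unique: "\<kappa> (a, b) = \<nu> (a, b)"
    if \<kappa>: "nontrivial_semigroup_law S' \<kappa>" "\<forall>a\<in>S'. \<forall>b\<in>S'. \<phi> (\<kappa> (a, b)) = \<mu> (\<phi> a, \<phi> b)"
      and ab: "a \<in> S'" "b \<in> S'" for \<kappa> a b
  proof -
    have \<kappa>m: "morphism_prod S' S' S' \<kappa>" and \<nu>m: "morphism_prod S' S' S' \<nu>"
      using \<kappa>(1) \<nu>_law unfolding nontrivial_semigroup_law_def algebraic_semigroup_law_def by blast+
    obtain c where c: "c \<in> C" "\<sigma> c \<noteq> P" using avoid by blast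
    have \<phi>\<kappa>: "\<phi> (\<kappa> (a, b)) = \<sigma> (m (\<pi>' a, \<pi>' b))" if "a \<in> S'" "b \<in> S'" for a b
      using \<kappa>(2) that \<mu> morphism_into[OF \<phi>] unfolding \<pi>'_def by simp
    note idm = morphism_id[OF S'p]
    from m(4) show ?thesis
    proof
      assume "\<forall>x\<in>C. \<forall>z\<in>C. \<exists>y\<in>C. m (x, y) = z"
      \<comment> \<open>The point \<open>\<sigma>' y\<close> is the witness for
        \<open>morphism_eqI\<close>: its product with \<open>a\<close> lies over
        \<open>\<sigma> c\<close>, which differs from \<open>P\<close>.\<close>
      then obtain y where y: "y \<in> C" "m (\<pi>' a, y) = c" using c(1) \<pi>'C[OF ab(1)] by blast
      note ca = morphism_const[OF S'p ab(1) S'p]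
      show ?thesis
      proof (rule morphism_eqI[OF S' morphism_prod_pair[OF \<kappa>m ca idm S'p S'p S'p]
            morphism_prod_pair[OF \<nu>m ca idm S'p S'p S'p] \<phi> Sp P \<phi>_inj _ \<sigma>'S[OF y(1)] _ ab(2)])
        show "\<phi> (\<kappa> (a, x)) = \<phi> (\<nu> (a, x))" if "x \<in> S'" for x using \<kappa>(2) \<nu>_hom ab(1) that by simp
        show "\<phi> (\<kappa> (a, \<sigma>' y)) \<noteq> P" using \<phi>\<kappa>[OF ab(1) \<sigma>'S[OF y(1)]] sec'[OF y(1)] y(2) c(2) by simp
      qed
    next
      assume "\<forall>y\<in>C. \<forall>z\<in>C. \<exists>x\<in>C. m (x, y) = z"
      \<comment> \<open>The mirror case, which the law m(x, y) = x requires: its products vary only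
        with the first argument.\<close>
      then obtain y where y: "y \<in> C" "m (y, \<pi>' b) = c" using c(1) \<pi>'C[OF ab(2)] by blast
      note cb = morphism_const[OF S'p ab(2) S'p]
      show ?thesis
      proof (rule morphism_eqI[OF S' morphism_prod_pair[OF \<kappa>m idm cb S'p S'p S'p]
            morphism_prod_pair[OF \<nu>m idm cb S'p S'p S'p] \<phi> Sp P \<phi>_inj _ \<sigma>'S[OF y(1)] _ ab(1)])
        show "\<phi> (\<kappa> (x, b)) = \<phi> (\<nu> (x, b))" if "x \<in> S'" for x using \<kappa>(2) \<nu>_hom ab(2) that by simp
        show "\<phi> (\<kappa> (\<sigma>' y, b)) \<noteq> P" using \<phi>\<kappa>[OF \<sigma>'S[OF y(1)] ab(2)] sec'[OF y(1)] y(2) c(2) by simp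
      qed
    qed
  qed
  show ?thesis
  proof (rule ex1I[of _ \<nu>])
    show "\<nu> \<in> extensional (S' \<times> S') \<and> nontrivial_semigroup_law S' \<nu> \<and>
      (\<forall>a\<in>S'. \<forall>b\<in>S'. \<phi> (\<nu> (a, b)) = \<mu> (\<phi> a, \<phi> b))"
      using \<nu>_law \<nu>_hom unfolding \<nu>_def by simp
  next
    fix \<kappa> assume \<kappa>: "\<kappa> \<in> extensional (S' \<times> S') \<and> nontrivial_semigroup_law S' \<kappa> \<and>
      (\<forall>a\<in>S'. \<forall>b\<in>S'. \<phi> (\<kappa> (a, b)) = \<mu> (\<phi> a, \<phi> b))"
    show "\<kappa> = \<nu>"
    \<comment> \<open>Both laws take the default value outside S' \<times> S', so agreement on pairs
      of points gives equality of functions.\<close>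
    proof (rule extensionalityI)
      show "\<kappa> \<in> extensional (S' \<times> S')" using \<kappa> by blast
      show "\<nu> \<in> extensional (S' \<times> S')" unfolding \<nu>_def by simp
      show "\<kappa> ab = \<nu> ab" if "ab \<in> S' \<times> S'" for ab using that unique[of \<kappa>] \<kappa> by (cases ab) auto
    qed
  qed
qed

end
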